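(* Let $O\subset\mathbb{R}^3$ be an octant, i.e. a set of the form $\{(x_1,x_2,x_3)\in\mathbb{R}^3:\ \varepsilon_i x_i\ge 0 \text{ for } i=1,2,3\}$ for some fixed signs $\varepsilon_1,\varepsilon_2,\varepsilon_3\in\{-1,1\}$. Octants are cover-decomposable into many coverings: for every integer $k\ge 2$, setting $m=12^{2^{k-1}+2^{k-2}-2}$ (note $m<12^{2^k}$), the following holds. For every set $X\subseteq\mathbb{R}^3$ and every finite family $\mathcal{F}$ of translates of $O$ such that every point of $X$ is contained in at least $m$ members of $\mathcal{F}$, the family $\mathcal{F}$ can be partitioned into $k$ subfamilies $\mathcal{F}_1,\dots,\mathcal{F}_k$ such that each $\mathcal{F}_j$ is a covering of $X$ (every point of $X$ lies in at least one member of $\mathcal{F}_j$). In particular, the minimal constant $m_O(k)$ with this property exists for every $k$ and satisfies $m_O(k)\le 12^{2^{k-1}+2^{k-2}-2}$ for $k\ge 2$.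
   Context: A family of sets is an $m$-fold covering of $X$ if every point of $X$ is contained in at least $m$ members of the family; a $1$-fold covering is called a covering. A set $P$ is cover-decomposable into $k$ coverings if there is a (minimal) constant $m_P(k)$ such that every $m_P(k)$-fold covering of any $X\subseteq\mathbb{R}^d$ by finitely many translates of $P$ can be decomposed (partitioned) into $k$ coverings of $X$; $P$ is cover-decomposable into many coverings if $m_P(k)$ exists for every $k$. *)

theory Defs
  imports "HOL-Analysis.Analysis" "HOL-Library.Multiset"
begin

text \<open>
  A finite family of sets is a finite multiset of sets, so the same set may occur in it several
  times; families without repetition are the multisets \<open>mset_set A\<close> for finite \<open>A\<close>.
\<close>

definition fold_covering :: "nat \<Rightarrow> 'a set multiset \<Rightarrow> 'a set \<Rightarrow> bool" where
  "fold_covering m F X \<longleftrightarrow> (\<forall>x\<in>X. m \<le> size {#S \<in># F. x \<in> S#})"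

definition covering :: "'a set multiset \<Rightarrow> 'a set \<Rightarrow> bool" where
  "covering F X \<longleftrightarrow> fold_covering 1 F X"

definition family_of_translates :: "(real ^ 'd) set \<Rightarrow> (real ^ 'd) set multiset \<Rightarrow> bool" where
  "family_of_translates P F \<longleftrightarrow> (\<forall>S\<in>#F. \<exists>v. S = (\<lambda>x. v + x) ` P)"

text \<open>
  The multiset sum expresses that \<open>F\<close> is partitioned into \<open>G 1, \<dots>, G k\<close>. Empty parts are not
  excluded, but a covering of a nonempty set is never empty.
\<close>

definition decomposes_into_coverings :: "nat \<Rightarrow> 'a set multiset \<Rightarrow> 'a set \<Rightarrow> bool" where
  "decomposes_into_coverings k F X \<longleftrightarrow>
     (\<exists>G. (\<Sum>j\<in>{1..k}. G j) = F \<and> (\<forall>j\<in>{1..k}. covering (G j) X))"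

definition fold_suffices :: "(real ^ 'd) set \<Rightarrow> nat \<Rightarrow> nat \<Rightarrow> bool" where
  "fold_suffices P k m \<longleftrightarrow>
     (\<forall>X F. family_of_translates P F \<longrightarrow> fold_covering m F X \<longrightarrow> decomposes_into_coverings k F X)"

definition cover_decomposable_into :: "nat \<Rightarrow> (real ^ 'd) set \<Rightarrow> bool" where
  "cover_decomposable_into k P \<longleftrightarrow> (\<exists>m. fold_suffices P k m)"

text \<open>The constant $m_P(k)$; meaningful only if \<open>cover_decomposable_into k P\<close>.\<close>

definition decomposition_constant :: "(real ^ 'd) set \<Rightarrow> nat \<Rightarrow> nat" where
  "decomposition_constant P k = (LEAST m. fold_suffices P k m)"

definition cover_decomposable_into_many :: "(real ^ 'd) set \<Rightarrow> bool" where
  "cover_decomposable_into_many P \<longleftrightarrow> (\<forall>k\<ge>1. cover_decomposable_into k P)"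

definition octant :: "(real ^ 3) set \<Rightarrow> bool" where
  "octant P \<longleftrightarrow> (\<exists>\<epsilon> :: real ^ 3. (\<forall>i. \<epsilon> $ i \<in> {-1, 1}) \<and> P = {x. \<forall>i. \<epsilon> $ i * x $ i \<ge> 0})"

end

theory Submission imports Defs begin

text \<open>
  Dually, finitely many points of space are to be coloured so that every octant \<open>{p. p \<le> w}\<close> that
  contains many of them contains all colours.

  Only antichains matter: colour the minimal points, let every other point remember the colour of
  some minimal point below it, and recolour each of the resulting classes with the remaining
  colours. An antichain is coloured with \<open>k + 1\<close> colours by first using two, so that every octant with
  12 points receives both, and then splitting one class further. If an octant contains only few
  points of that class, say \<open>n\<close>, its other points are covered by \<open>(n + 1)\<^sup>2\<close> octants avoiding the
  class, each with at most 11 points.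

  For two colours read the third coordinate as time. In the plane the points arrive one by one; the
  points alive at a given moment form a staircase, and a new point removes an interval of it. A
  point is anchored if it has removed an unanchored point (its anchor) and, as long as it lives,
  nothing else arrives below that point. Every octant that contains neighbours of an anchored point
  on both sides also contains its anchor. An anchored point gets the colour opposite to the point
  that will remove it, and shows its neighbours the colour of its anchor. An unanchored
  point is coloured differently from its neighbours; if these show different colours it stays
  undecided, until its neighbours agree, or until it is removed, when it gets the colour opposite to
  the point removing it. In a monochromatic octant all removed points are therefore unanchored and
  decided. Following its evolution in time, an octant of this kind has at most 5 points alive at the
  end, and at most 6 of its points have removed another of its points.
\<close>

section \<open>Staircases evolving in time\<close>

text \<open>
  Points are numbered in the order of arrival. The points 0 and 1 are artificial ends of the
  staircase, so that every other point alive has a neighbour on either side.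
\<close>

locale staircase =
  fixes n :: nat and x y :: "nat \<Rightarrow> real"
  assumes two: "2 \<le> n"
    and inj_x: "inj_on x {..<n}" and inj_y: "inj_on y {..<n}"
    and antichain: "\<lbrakk>p < q; q < n\<rbrakk> \<Longrightarrow> \<not> (x p < x q \<and> y p < y q)"
    and left_end: "\<lbrakk>p < n; p \<noteq> 0\<rbrakk> \<Longrightarrow> x 0 < x p \<and> y p < y 0"
    and right_end: "\<lbrakk>p < n; p \<noteq> 1\<rbrakk> \<Longrightarrow> x p < x 1 \<and> y 1 < y p"
begin

definition below :: "nat \<Rightarrow> nat \<Rightarrow> bool" where
  "below q p \<longleftrightarrow> x q < x p \<and> y q < y p"

text \<open>A point that is never removed dies at time \<open>n\<close>.\<close>

definition death :: "nat \<Rightarrow> nat" where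
  "death p = (LEAST q. p < q \<and> (q < n \<longrightarrow> below q p) \<and> q \<le> max n (Suc p))"

definition alive :: "nat \<Rightarrow> nat \<Rightarrow> bool" where
  "alive t p \<longleftrightarrow> p \<le> t \<and> t < death p"

definition btw :: "nat \<Rightarrow> nat \<Rightarrow> nat \<Rightarrow> bool" where
  "btw a m b \<longleftrightarrow> x a < x m \<and> x m < x b \<or> x b < x m \<and> x m < x a"

definition nbr :: "nat \<Rightarrow> nat \<Rightarrow> nat \<Rightarrow> bool" where
  "nbr t a b \<longleftrightarrow> alive t a \<and> alive t b \<and> a \<noteq> b \<and> (\<forall>m. alive t m \<longrightarrow> \<not> btw a m b)"

section \<open>Survival, neighbours and removal on the staircase\<close>

lemma x_neq: "p < n \<Longrightarrow> q < n \<Longrightarrow> p \<noteq> q \<Longrightarrow> x p \<noteq> x q"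
  using inj_x by (auto simp: inj_on_def)

lemma y_neq: "p < n \<Longrightarrow> q < n \<Longrightarrow> p \<noteq> q \<Longrightarrow> y p \<noteq> y q"
  using inj_y by (auto simp: inj_on_def)

lemma death_props:
  shows "p < death p" "death p < n \<Longrightarrow> below (death p) p" "p < n \<Longrightarrow> death p \<le> n"
proof -
  \<comment> \<open>\<open>max n (Suc p)\<close> always qualifies, so the \<open>LEAST\<close> in
    \<open>death\<close> exists even for an index outside the range, where it equals
    \<open>Suc p\<close>.\<close>
  have "p < max n (Suc p) \<and> (max n (Suc p) < n \<longrightarrow> below (max n (Suc p)) p) \<and> max n (Suc p) \<le> max n (Suc p)"
    by auto
  from LeastI[of "\<lambda>q. p < q \<and> (q < n \<longrightarrow> below q p) \<and> q \<le> max n (Suc p)", OF this]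
  have *: "p < death p \<and> (death p < n \<longrightarrow> below (death p) p) \<and> death p \<le> max n (Suc p)"
    unfolding death_def .
  then show "p < death p" "death p < n \<Longrightarrow> below (death p) p" by auto
  show "p < n \<Longrightarrow> death p \<le> n" using * by auto
qed

lemma death_le: "p < q \<Longrightarrow> q < n \<Longrightarrow> below q p \<Longrightarrow> death p \<le> q"
  unfolding death_def by (rule Least_le) auto

lemma alive_self [simp]: "alive p p"
  using death_props(1)[of p] by (simp add: alive_def)

lemma alive_le: "alive t p \<Longrightarrow> p \<le> t" by (simp add: alive_def)

lemma alive_mono: "alive t p \<Longrightarrow> p \<le> s \<Longrightarrow> s \<le> t \<Longrightarrow> alive s p"
  by (auto simp: alive_def)

text \<open>If the lower point came later, it would have removed the other; if it came earlier,
  \<open>antichain\<close> excludes the pair.\<close>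

lemma alive_antichain:
  assumes "alive t a" "alive t b" "t < n" shows "\<not> below a b"
proof
  assume ab: "below a b"
  then have "a \<noteq> b" by (auto simp: below_def)
  then consider "a < b" | "b < a" by linarith
  then show False
  proof cases
    case 1 then show ?thesis using antichain[of a b] ab assms by (auto simp: below_def alive_def)
  next
    case 2 then show ?thesis using death_le[of b a] ab assms by (auto simp: alive_def)
  qed
qed

lemma alive_xy:
  assumes "alive t a" "alive t b" "t < n" shows "x a < x b \<longleftrightarrow> y b < y a"
proof (cases "a = b")
  case False
  then have "y a \<noteq> y b" "x a \<noteq> x b" using assms x_neq y_neq by (auto simp: alive_def)
  then show ?thesis using alive_antichain[OF assms] alive_antichain[OF assms(2,1,3)]
    by (auto simp: below_def)
qed simp

lemma ends_alive:
  assumes "t < n" "1 \<le> t" shows "alive t 0" "alive t 1"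
proof -
  have "\<not> death 0 < n" using death_props(1,2)[of 0] left_end[of "death 0"] by (auto simp: below_def)
  then show "alive t 0" using assms by (simp add: alive_def)
  have "\<not> death 1 < n" using death_props(1,2)[of 1] right_end[of "death 1"] by (auto simp: below_def)
  then show "alive t 1" using assms by (simp add: alive_def)
qed

text \<open>Follow the removals from \<open>p\<close>: each killer comes later and lies below its
  victim, so the chain stops at a point alive at time \<open>t\<close>.\<close>

lemma dominator:
  assumes "p \<le> t" "t < n"
  shows "\<exists>e. alive t e \<and> p \<le> e \<and> (e = p \<or> below e p)"
  using assms(1)
proof (induction "t - p" arbitrary: p rule: less_induct)
  case less
  show ?case
  proof (cases "alive t p")
    case False
    then have dp: "death p \<le> t" using less.prems by (auto simp: alive_def)
    have lt: "p < death p" by (rule death_props)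
    have bl: "below (death p) p" using death_props(2)[of p] dp assms by auto
    have "t - death p < t - p" using lt dp by linarith
    then obtain e where e: "alive t e" "death p \<le> e" "e = death p \<or> below e (death p)"
      using less.hyps[of "death p"] dp by blast
    have "below e p" using e(3) bl by (auto simp: below_def)
    then show ?thesis using e lt by (metis less_imp_le order.trans)
  qed auto
qed

lemma nbr_sym: "nbr t a b \<longleftrightarrow> nbr t b a"
  unfolding nbr_def btw_def by blast

lemma nbr_alive: "nbr t a b \<Longrightarrow> alive t a" "nbr t a b \<Longrightarrow> alive t b" "nbr t a b \<Longrightarrow> a \<noteq> b"
  by (auto simp: nbr_def)

lemma finite_alive: "finite {m. alive t m \<and> P m}"
  by (rule finite_subset[of _ "{..t}"]) (auto simp: alive_def)

text \<open>Take the point horizontally closest to \<open>w\<close> on the side of \<open>a\<close>.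
  This is the first step of a walk along the staircase from \<open>w\<close> to
  \<open>a\<close>.\<close>

lemma nearest:
  assumes "alive t a" "alive t w" "a \<noteq> w" "t < n"
  shows "\<exists>m. nbr t m w \<and> (m = a \<or> btw a m w)"
proof -
  let ?M = "{m. alive t m \<and> (m = a \<or> btw a m w)}"
  have fin: "finite ?M" by (rule finite_alive)
  have ne: "?M \<noteq> {}" using assms by auto
  define m where "m = arg_min_on (\<lambda>m. \<bar>x m - x w\<bar>) ?M"
  have mM: "m \<in> ?M" using arg_min_if_finite(1)[OF fin ne] by (simp add: m_def)
  have least: "\<bar>x m - x w\<bar> \<le> \<bar>x k - x w\<bar>" if "k \<in> ?M" for k
    using arg_min_least[OF fin ne that] by (simp add: m_def)
  have xav: "x a \<noteq> x w" using assms x_neq by (auto simp: alive_def)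
  have "nbr t m w"
    unfolding nbr_def
  proof (intro conjI allI impI)
    show "alive t m" "alive t w" using mM assms by auto
    show "m \<noteq> w" using mM xav by (auto simp: btw_def)
    fix k assume k: "alive t k"
    show "\<not> btw m k w"
    proof
      assume b: "btw m k w"
      then have "btw a k w" using mM by (auto simp: btw_def)
      then have "k \<in> ?M" using k by auto
      from least[OF this] b show False by (auto simp: btw_def)
    qed
  qed
  then show ?thesis using mM by auto
qed

lemma nbr_unique:
  assumes "nbr t a b" "nbr t a' b" "x a < x b \<longleftrightarrow> x a' < x b" "t < n"
  shows "a = a'"
proof (rule ccontr)
  assume "a \<noteq> a'"
  then have "x a \<noteq> x a'" using assms x_neq by (auto simp: nbr_def alive_def)
  moreover have "x a \<noteq> x b" "x a' \<noteq> x b" using assms x_neq by (auto simp: nbr_def alive_def)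
  ultimately show False using assms unfolding nbr_def btw_def by (smt (verit))
qed

lemma ex_left:
  assumes "alive t p" "p \<noteq> 0" "1 \<le> t" "t < n" shows "\<exists>l. nbr t l p \<and> x l < x p"
proof -
  have x0: "x 0 < x p" using left_end[of p] assms by (auto simp: alive_def)
  obtain m where "nbr t m p" "m = 0 \<or> btw 0 m p"
    using nearest[of t 0 p] ends_alive assms by auto
  then show ?thesis using x0 by (auto simp: btw_def)
qed

lemma ex_right:
  assumes "alive t p" "p \<noteq> 1" "1 \<le> t" "t < n" shows "\<exists>l. nbr t l p \<and> x p < x l"
proof -
  have x0: "x p < x 1" using right_end[of p] assms by (auto simp: alive_def)
  obtain m where "nbr t m p" "m = 1 \<or> btw 1 m p"
    using nearest[of t 1 p] ends_alive assms by auto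
  then show ?thesis using x0 by (auto simp: btw_def)
qed

text \<open>A point that separated \<open>a\<close> and \<open>b\<close> at time \<open>s\<close>
  has a dominator alive at time \<open>t\<close>, and by the order of the staircase this dominator
  still separates them.\<close>

lemma nbr_history:
  assumes "nbr t a b" "alive s a" "alive s b" "s \<le> t" "t < n"
  shows "nbr s a b"
proof -
  have *: False if ab: "nbr t a b" and xab: "x a < x b" and m: "alive s m" "x a < x m" "x m < x b"
    and sa: "alive s a" and sb: "alive s b" for a b m
  proof -
    have ys: "y b < y m" "y m < y a" using alive_xy[of s] m sa sb assms by auto
    obtain e where e: "alive t e" "e = m \<or> below e m"
      using dominator[of m t] m assms by (auto simp: alive_def)
    have le: "x e < x b" "y e < y a" using e ys m by (auto simp: below_def)
    have ta: "alive t a" "alive t b" using ab by (auto simp: nbr_def)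
    have "x a < x e" using alive_xy[OF ta(1) e(1)] le assms by auto
    then show False using ab e(1) le by (auto simp: nbr_def btw_def)
  qed
  have ba: "nbr t b a" using assms(1) nbr_sym by blast
  have "\<not> btw a m b" if "alive s m" for m
    using *[OF assms(1) _ that _ _ assms(2,3)] *[OF ba _ that _ _ assms(3,2)]
    unfolding btw_def by (meson order.strict_trans)
  then show ?thesis unfolding nbr_def using assms(1-3) by (simp add: nbr_alive(3))
qed

lemma alive_step:
  assumes "alive t m" "Suc t < n"
  shows "alive (Suc t) m \<longleftrightarrow> \<not> below (Suc t) m" "\<not> alive (Suc t) m \<longleftrightarrow> death m = Suc t"
proof -
  have "m \<le> t" "t < death m" using assms by (auto simp: alive_def)
  show eq: "\<not> alive (Suc t) m \<longleftrightarrow> death m = Suc t"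
    using \<open>m \<le> t\<close> \<open>t < death m\<close> by (auto simp: alive_def)
  have "below (Suc t) m \<longleftrightarrow> death m = Suc t"
    using death_props(2)[of m] death_le[of m "Suc t"] \<open>m \<le> t\<close> \<open>t < death m\<close> assms by fastforce
  then show "alive (Suc t) m \<longleftrightarrow> \<not> below (Suc t) m" using eq by blast
qed

lemma alive_stepD: "alive (Suc t) m \<Longrightarrow> m \<noteq> Suc t \<Longrightarrow> alive t m"
  by (auto simp: alive_def)

text \<open>The points removed by an arrival form an interval of the staircase, and a surviving
  neighbour of the arrival borders on this interval.\<close>

lemma removed_between:
  assumes "Suc t < n" "nbr (Suc t) s (Suc t)" "alive t w" "death w = Suc t" "alive t m" "btw s m w"
  shows "death m = Suc t"
proof (rule ccontr)
  let ?z = "Suc t"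
  assume "death m \<noteq> ?z"
  then have mz: "alive ?z m" using alive_step[OF assms(5,1)] by auto
  have zv: "below ?z w" using death_props(2)[of w] assms by auto
  have sz: "alive ?z s" "s \<noteq> ?z" using assms(2) by (auto simp: nbr_def)
  then have st: "alive t s" by (rule alive_stepD)
  have nb: "\<not> btw s m ?z" using mz assms(2) by (auto simp: nbr_def)
  have nbm: "\<not> below ?z m" using alive_step[OF assms(5,1)] mz by auto
  have tn: "t < n" using assms by auto
  have mne: "m \<noteq> ?z" using assms(5) by (auto simp: alive_def)
  then have xm: "x m \<noteq> x ?z" using x_neq[of m ?z] assms mz by (auto simp: alive_def)
  show False
  proof (cases "x s < x w")
    case True
    then have m1: "x s < x m" "x m < x w" using assms(6) by (auto simp: btw_def)
    have ym: "y w < y m" using alive_xy[OF assms(5,3) tn] m1 by auto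
    show False
    proof (cases "x s < x ?z")
      case True
      then have "x ?z < x m" using nb m1 xm by (auto simp: btw_def)
      then show False using nbm zv ym by (auto simp: below_def)
    next
      case False
      then have "x ?z < x s" using x_neq[of s ?z] sz assms by (auto simp: alive_def)
      then have "y s < y ?z" using alive_xy[of ?z ?z s] sz assms by auto
      moreover have "y w < y s" using alive_xy[OF st assms(3) tn] True by auto
      ultimately show False using zv by (auto simp: below_def)
    qed
  next
    case False
    then have m1: "x w < x m" "x m < x s" using assms(6) by (auto simp: btw_def)
    then show False using nb zv by (auto simp: btw_def below_def)
  qed
qed

section \<open>Anchored points\<close>

definition narrow :: "nat \<Rightarrow> bool" where
  "narrow u \<longleftrightarrow> (\<forall>q. death u < q \<longrightarrow> q < death (death u) \<longrightarrow> \<not> below q u)"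

text \<open>The recursion is on arrival times, as a victim precedes its killer. An anchor must
  itself be unanchored so that the colour it shows, and passes on, is its own.\<close>

function anchored :: "nat \<Rightarrow> bool" where
  "anchored p = (\<exists>u\<in>{..<p}. death u = p \<and> narrow u \<and> \<not> anchored u)"
  by pat_completeness auto
termination by (relation "Wellfounded.measure (\<lambda>p. p)") auto

declare anchored.simps [simp del]

definition anchor :: "nat \<Rightarrow> nat" where
  "anchor p = (SOME u. death u = p \<and> narrow u \<and> \<not> anchored u)"

lemma anchor_props: assumes "anchored p" shows "death (anchor p) = p" "narrow (anchor p)" "\<not> anchored (anchor p)" "anchor p < p"
proof -
  obtain u where "death u = p \<and> narrow u \<and> \<not> anchored u" using assms by (subst (asm) anchored.simps) auto
  from someI[of "\<lambda>u. death u = p \<and> narrow u \<and> \<not> anchored u", OF this]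
  show "death (anchor p) = p" "narrow (anchor p)" "\<not> anchored (anchor p)" by (auto simp: anchor_def)
  then show "anchor p < p" using death_props(1)[of "anchor p"] by simp
qed

lemma unanchored_child: "\<not> anchored p \<Longrightarrow> death u = p \<Longrightarrow> \<not> anchored u \<Longrightarrow> \<not> narrow u"
  using death_props(1)[of u] by (subst (asm) anchored.simps) auto

end

section \<open>The colouring process\<close>

text \<open>
  A new unanchored point, with colour \<open>gp\<close> or undecided (\<open>None\<close>), is inserted between neighbours \<open>l\<close> and
  \<open>r\<close> in states \<open>cl\<close> and \<open>cr\<close>, whose outer neighbours show \<open>cll\<close> and \<open>crr\<close>. A maximal stretch of
  undecided points gets alternating colours if this is compatible with both of its ends; otherwise
  the point of the stretch that dies first stays undecided.
\<close>

lemma local_colouring: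
  fixes cl cr cll crr :: "bool option" and dl dp dr :: nat
  assumes "cl = None \<longrightarrow> cll \<noteq> None" "cr = None \<longrightarrow> crr \<noteq> None"
  shows "\<exists>gp gl gr.
    (cl \<noteq> None \<longrightarrow> gl = cl) \<and> (cr \<noteq> None \<longrightarrow> gr = cr) \<and>
    (gp = None \<longrightarrow> gl \<noteq> None \<and> gr \<noteq> None \<and> gl \<noteq> gr) \<and>
    (gl = None \<longrightarrow> gp \<noteq> None \<and> cll \<noteq> gp) \<and>
    (gr = None \<longrightarrow> gp \<noteq> None \<and> crr \<noteq> gp) \<and>
    (gp \<noteq> None \<longrightarrow> gl \<noteq> gp \<and> gr \<noteq> gp) \<and>
    (cl = None \<and> gl \<noteq> None \<longrightarrow> cll \<noteq> gl) \<and>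
    (cr = None \<and> gr \<noteq> None \<longrightarrow> crr \<noteq> gr) \<and>
    (cl = None \<longrightarrow> (gp = None \<and> gl \<noteq> None \<longrightarrow> dp \<le> dl) \<and> (gl = None \<and> gp \<noteq> None \<longrightarrow> dl \<le> dp)) \<and>
    (cr = None \<longrightarrow> (gp = None \<and> gr \<noteq> None \<longrightarrow> dp \<le> dr) \<and> (gr = None \<and> gp \<noteq> None \<longrightarrow> dr \<le> dp))"
    (is "\<exists>gp gl gr. ?P gp gl gr")
proof -
  have w: ?thesis if "?P gp gl gr" for gp gl gr using that by (intro exI)
  have opp: "a = b \<or> b = (\<not> a)" for a b :: bool by (cases a; cases b) simp_all
  show ?thesis
  proof (cases cl)
    case cl: None
    then obtain a where a: "cll = Some a" using assms by auto
    show ?thesis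
    proof (cases cr)
      case cr: None
      then obtain b where b: "crr = Some b" using assms by auto
      \<comment> \<open>Three undecided points between outer colours \<open>a\<close> and
        \<open>b\<close> can alternate only if \<open>a = b\<close>. Otherwise one that dies first
        among the three is left undecided.\<close>
      have m: "dp \<le> dl \<and> dp \<le> dr \<or> dl \<le> dp \<and> dl \<le> dr \<or> dr \<le> dp \<and> dr \<le> dl" by linarith
      show ?thesis using opp[of a b]
      proof
        assume "a = b"
        then show ?thesis using a b cl cr by (intro w[where gp="Some a" and gl="Some (\<not> a)" and gr="Some (\<not> a)"]) simp
      next
        assume ab: "b = (\<not> a)"
        from m show ?thesis
        proof (elim disjE)
          assume "dp \<le> dl \<and> dp \<le> dr"
          then show ?thesis using ab a b cl cr by (intro w[where gp=None and gl="Some (\<not> a)" and gr="Some a"]) simp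
        next
          assume "dl \<le> dp \<and> dl \<le> dr"
          then show ?thesis using ab a b cl cr by (intro w[where gp="Some (\<not> a)" and gl=None and gr="Some a"]) simp
        next
          assume "dr \<le> dp \<and> dr \<le> dl"
          then show ?thesis using ab a b cl cr by (intro w[where gp="Some a" and gl="Some (\<not> a)" and gr=None]) simp
        qed
      qed
    next
      case cr: (Some b)
      show ?thesis using opp[of a b]
      proof
        assume ab: "b = (\<not> a)"
        then show ?thesis using a cl cr by (intro w[where gp="Some a" and gl="Some (\<not> a)" and gr="Some (\<not> a)"]) simp
      next
        assume ab: "a = b"
        show ?thesis
        proof (cases "dl \<le> dp")
          case True
          then show ?thesis using ab a cl cr by (intro w[where gp="Some (\<not> b)" and gl=None and gr="Some b"]) simp
        next
          case False
          then show ?thesis using ab a cl cr by (intro w[where gp=None and gl="Some (\<not> b)" and gr="Some b"]) simp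
        qed
      qed
    qed
  next
    case cl: (Some a)
    show ?thesis
    proof (cases cr)
      case cr: None
      then obtain b where b: "crr = Some b" using assms by auto
      show ?thesis using opp[of a b]
      proof
        assume ab: "b = (\<not> a)"
        then show ?thesis using b cl cr by (intro w[where gp="Some (\<not> a)" and gl="Some a" and gr="Some a"]) simp
      next
        assume ab: "a = b"
        show ?thesis
        proof (cases "dr \<le> dp")
          case True
          then show ?thesis using ab b cl cr by (intro w[where gp="Some (\<not> b)" and gl="Some b" and gr=None]) simp
        next
          case False
          then show ?thesis using ab b cl cr by (intro w[where gp=None and gl="Some b" and gr="Some (\<not> b)"]) simp
        qed
      qed
    next
      case cr: (Some b)
      show ?thesis using opp[of a b]
      proof
        assume "a = b"
        then show ?thesis using cl cr by (intro w[where gp="Some (\<not> a)" and gl="Some a" and gr="Some a"]) simp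
      next
        assume "b = (\<not> a)"
        then show ?thesis using cl cr by (intro w[where gp=None and gl="Some a" and gr="Some (\<not> a)"]) simp
      qed
    qed
  qed
qed

section \<open>Updating the colouring after one arrival\<close>

context staircase begin

text \<open>The invariant of the process: an undecided point is isolated and wedged between
  different colours, so neither colour could be given to it without a clash.\<close>

definition proper :: "nat \<Rightarrow> (nat \<Rightarrow> bool option) \<Rightarrow> bool" where
  "proper t G \<longleftrightarrow> (\<forall>e. alive t e \<and> G e = None \<longrightarrow>
     \<not> anchored e \<and> e \<noteq> 0 \<and> e \<noteq> 1 \<and> (\<forall>b. nbr t e b \<longrightarrow> G b \<noteq> None) \<and>
     (\<forall>b b'. nbr t e b \<longrightarrow> nbr t e b' \<longrightarrow> b \<noteq> b' \<longrightarrow> G b \<noteq> G b'))"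

text \<open>The death times serve the later counting: inside a monochromatic octant an undecided
  point cannot be removed, so its decided partner, which lives at least as long, is safe too. The
  default \<open>True\<close> lets an anchored arrival show a colour even if its anchor died
  undecided.\<close>

definition extends :: "nat \<Rightarrow> (nat \<Rightarrow> bool option) \<Rightarrow> (nat \<Rightarrow> bool option) \<Rightarrow> bool" where
  "extends t G G' \<longleftrightarrow>
     (\<forall>e. e \<noteq> Suc t \<longrightarrow> G e \<noteq> None \<longrightarrow> G' e = G e) \<and>
     (anchored (Suc t) \<longrightarrow> G' (Suc t) = Some (case G (anchor (Suc t)) of Some b \<Rightarrow> b | None \<Rightarrow> True)) \<and>
     (\<forall>e b. (e = Suc t \<and> \<not> anchored e \<or> e \<noteq> Suc t \<and> G e = None) \<longrightarrow> G' e \<noteq> None \<longrightarrow>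
        nbr (Suc t) e b \<longrightarrow> G' b \<noteq> G' e) \<and>
     (\<forall>w. \<not> anchored (Suc t) \<longrightarrow> nbr (Suc t) (Suc t) w \<longrightarrow> G w = None \<longrightarrow>
        (G' (Suc t) = None \<and> G' w \<noteq> None \<longrightarrow> death (Suc t) \<le> death w) \<and>
        (G' w = None \<and> G' (Suc t) \<noteq> None \<longrightarrow> death w \<le> death (Suc t)))"

lemma two_nbrs:
  assumes "alive t e" "e \<noteq> 0" "e \<noteq> 1" "1 \<le> t" "t < n"
  shows "\<exists>l r. nbr t e l \<and> nbr t e r \<and> l \<noteq> r \<and> (\<forall>b. nbr t e b \<longrightarrow> b = l \<or> b = r)"
proof -
  obtain l where l: "nbr t l e" "x l < x e" using ex_left[of t e] assms by auto
  obtain r where r: "nbr t r e" "x e < x r" using ex_right[of t e] assms by auto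
  have "b = l \<or> b = r" if b: "nbr t e b" for b
  proof -
    have "x b \<noteq> x e" using b x_neq[of b e] assms by (auto simp: nbr_def alive_def)
    then show ?thesis
      using nbr_unique[of t b e l] nbr_unique[of t b e r] b l r assms nbr_sym by force
  qed
  moreover have "l \<noteq> r" using l r by auto
  ultimately show ?thesis using l r nbr_sym by blast
qed

lemma other_nbr:
  assumes "nbr t e b" "e \<noteq> 0" "e \<noteq> 1" "1 \<le> t" "t < n"
  shows "\<exists>c. nbr t e c \<and> c \<noteq> b \<and> (\<forall>b'. nbr t e b' \<longrightarrow> b' = b \<or> b' = c)"
proof -
  obtain l r where "nbr t e l" "nbr t e r" "l \<noteq> r" "\<forall>b. nbr t e b \<longrightarrow> b = l \<or> b = r"
    using two_nbrs[of t e] assms by (auto simp: nbr_def)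
  then show ?thesis using assms by metis
qed

lemma extension_exists:
  assumes t: "1 \<le> t" "Suc t < n" and ok: "proper t G"
  shows "\<exists>G'. proper (Suc t) G' \<and> extends t G G'"
proof -
  let ?p = "Suc t"
  have tn: "t < n" "1 \<le> ?p" using t by auto
  obtain l r where lr: "nbr ?p ?p l" "nbr ?p ?p r" "l \<noteq> r" "\<And>b. nbr ?p ?p b \<Longrightarrow> b = l \<or> b = r"
    using two_nbrs[of ?p ?p] t by auto
  have lrp: "l \<noteq> ?p" "r \<noteq> ?p" using lr by (auto simp: nbr_def)
  have okD: "\<not> anchored e" "e \<noteq> 0" "e \<noteq> 1" "nbr t e b \<Longrightarrow> G b \<noteq> None"
     "nbr t e b \<Longrightarrow> nbr t e b' \<Longrightarrow> b \<noteq> b' \<Longrightarrow> G b \<noteq> G b'"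
    if "alive t e" "G e = None" for e b b'
    using ok that unfolding proper_def by metis+
  \<comment> \<open>Edges of the new staircase that avoid the arrival are old edges, so
    \<open>proper t G\<close> speaks about them.\<close>
  have old: "nbr t a b" if "nbr ?p a b" "a \<noteq> ?p" "b \<noteq> ?p" for a b
    using nbr_history[OF that(1), of t] alive_stepD[of t a] alive_stepD[of t b] nbr_alive[OF that(1)] that t
    by auto
  \<comment> \<open>An undecided neighbour of the arrival has a decided neighbour on its far side,
    because undecided points were isolated.\<close>
  have outer: "\<exists>c. nbr ?p s c \<and> c \<noteq> ?p \<and> (\<forall>b'. nbr ?p s b' \<longrightarrow> b' = ?p \<or> b' = c) \<and> G c \<noteq> None"
    if s: "nbr ?p ?p s" "G s = None" for s
  proof -
    have sp: "s \<noteq> ?p" "alive t s" using s alive_stepD by (auto simp: nbr_def)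
    have "nbr ?p s ?p" using s nbr_sym by blast
    then obtain c where c: "nbr ?p s c" "c \<noteq> ?p" "\<forall>b'. nbr ?p s b' \<longrightarrow> b' = ?p \<or> b' = c"
      using other_nbr[of ?p s ?p] okD(2,3)[OF sp(2) s(2)] t by auto
    then show ?thesis using okD(4)[OF sp(2) s(2), of c] old[of s c] sp by blast
  qed
  \<comment> \<open>\<open>ll\<close> and \<open>rr\<close> carry information only if
    \<open>l\<close>, respectively \<open>r\<close>, is undecided.\<close>
  define ll where "ll = (SOME c. nbr ?p l c \<and> c \<noteq> ?p \<and> (\<forall>b'. nbr ?p l b' \<longrightarrow> b' = ?p \<or> b' = c) \<and> G c \<noteq> None)"
  define rr where "rr = (SOME c. nbr ?p r c \<and> c \<noteq> ?p \<and> (\<forall>b'. nbr ?p r b' \<longrightarrow> b' = ?p \<or> b' = c) \<and> G c \<noteq> None)"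
  have ll: "nbr ?p l ll" "ll \<noteq> ?p" "\<And>b'. nbr ?p l b' \<Longrightarrow> b' = ?p \<or> b' = ll" "G ll \<noteq> None" if "G l = None"
    using someI_ex[OF outer[OF lr(1) that]] unfolding ll_def by blast+
  have rr: "nbr ?p r rr" "rr \<noteq> ?p" "\<And>b'. nbr ?p r b' \<Longrightarrow> b' = ?p \<or> b' = rr" "G rr \<noteq> None" if "G r = None"
    using someI_ex[OF outer[OF lr(2) that]] unfolding rr_def by blast+
  have llr: "ll \<noteq> l" if "G l = None" using ll[OF that] by (auto simp: nbr_def)
  have rrr: "rr \<noteq> r" if "G r = None" using rr[OF that] by (auto simp: nbr_def)
  define gz where "gz = Some (case G (anchor ?p) of Some b \<Rightarrow> b | None \<Rightarrow> True)"
  \<comment> \<open>Only the arrival and its two neighbours can receive a new state; these are all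
    the conditions on the three values.\<close>
  have "\<exists>gp gl gr.
    (G l \<noteq> None \<longrightarrow> gl = G l) \<and> (G r \<noteq> None \<longrightarrow> gr = G r) \<and>
    (gp = None \<longrightarrow> gl \<noteq> None \<and> gr \<noteq> None \<and> gl \<noteq> gr) \<and>
    (gl = None \<longrightarrow> gp \<noteq> None \<and> G ll \<noteq> gp) \<and>
    (gr = None \<longrightarrow> gp \<noteq> None \<and> G rr \<noteq> gp) \<and>
    (anchored ?p \<longrightarrow> gp = gz) \<and>
    (\<not> anchored ?p \<and> gp \<noteq> None \<longrightarrow> gl \<noteq> gp \<and> gr \<noteq> gp) \<and>
    (G l = None \<and> gl \<noteq> None \<longrightarrow> G ll \<noteq> gl \<and> gp \<noteq> gl) \<and>
    (G r = None \<and> gr \<noteq> None \<longrightarrow> G rr \<noteq> gr \<and> gp \<noteq> gr) \<and>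
    (\<not> anchored ?p \<and> G l = None \<longrightarrow> (gp = None \<and> gl \<noteq> None \<longrightarrow> death ?p \<le> death l) \<and> (gl = None \<and> gp \<noteq> None \<longrightarrow> death l \<le> death ?p)) \<and>
    (\<not> anchored ?p \<and> G r = None \<longrightarrow> (gp = None \<and> gr \<noteq> None \<longrightarrow> death ?p \<le> death r) \<and> (gr = None \<and> gp \<noteq> None \<longrightarrow> death r \<le> death ?p))"
    (is "\<exists>gp gl gr. ?P gp gl gr")
  proof (cases "anchored ?p")
    case False
    have "G l = None \<longrightarrow> G ll \<noteq> None" "G r = None \<longrightarrow> G rr \<noteq> None" using ll(4) rr(4) by blast+
    from local_colouring[of "G l" "G ll" "G r" "G rr" "death ?p" "death l" "death r", OF this]
    show ?thesis
    proof (elim exE conjE, goal_cases)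
      case (1 gp gl gr)
      have ne: "gl \<noteq> None \<longrightarrow> gp \<noteq> gl" "gr \<noteq> None \<longrightarrow> gp \<noteq> gr" using 1(6) by metis+
      show ?thesis
        by (rule exI[of _ gp], rule exI[of _ gl], rule exI[of _ gr], intro conjI)
          (use 1 ne False in metis)+
    qed
  next
    case True
    obtain e where e: "gz = Some e" by (auto simp: gz_def)
    \<comment> \<open>The colour \<open>e\<close> shown by the arrival is forced. An undecided
      neighbour takes the opposite colour if its outer neighbour also shows \<open>e\<close>, and
      otherwise stays wedged between different colours.\<close>
    define f where "f c1 c2 = (case c1 of Some b \<Rightarrow> Some b | None \<Rightarrow> if c2 = Some e then Some (\<not> e) else None)"
      for c1 c2 :: "bool option"
    have f: "c1 \<noteq> None \<longrightarrow> f c1 c2 = c1" "f c1 c2 = None \<longrightarrow> c2 \<noteq> gz"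
      "c1 = None \<and> f c1 c2 \<noteq> None \<longrightarrow> c2 \<noteq> f c1 c2 \<and> gz \<noteq> f c1 c2" for c1 c2
      by (cases c1; auto simp: f_def e)+
    have gz: "gz \<noteq> None" using e by simp
    show ?thesis
      by (rule exI[of _ gz], rule exI[of _ "f (G l) (G ll)"], rule exI[of _ "f (G r) (G rr)"], intro conjI)
        (use True f gz in metis)+
  qed
  then obtain gp gl gr where
    Pl: "G l \<noteq> None \<longrightarrow> gl = G l" and Pr: "G r \<noteq> None \<longrightarrow> gr = G r" and
    Pp: "gp = None \<longrightarrow> gl \<noteq> None \<and> gr \<noteq> None \<and> gl \<noteq> gr" and
    Pnl: "gl = None \<longrightarrow> gp \<noteq> None \<and> G ll \<noteq> gp" and
    Pnr: "gr = None \<longrightarrow> gp \<noteq> None \<and> G rr \<noteq> gp" and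
    Pz: "anchored ?p \<longrightarrow> gp = gz" and
    Pd: "\<not> anchored ?p \<and> gp \<noteq> None \<longrightarrow> gl \<noteq> gp \<and> gr \<noteq> gp" and
    Pdl: "G l = None \<and> gl \<noteq> None \<longrightarrow> G ll \<noteq> gl \<and> gp \<noteq> gl" and
    Pdr: "G r = None \<and> gr \<noteq> None \<longrightarrow> G rr \<noteq> gr \<and> gp \<noteq> gr" and
    Pkl: "\<not> anchored ?p \<and> G l = None \<longrightarrow> (gp = None \<and> gl \<noteq> None \<longrightarrow> death ?p \<le> death l) \<and> (gl = None \<and> gp \<noteq> None \<longrightarrow> death l \<le> death ?p)" and
    Pkr: "\<not> anchored ?p \<and> G r = None \<longrightarrow> (gp = None \<and> gr \<noteq> None \<longrightarrow> death ?p \<le> death r) \<and> (gr = None \<and> gp \<noteq> None \<longrightarrow> death r \<le> death ?p)"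
    by (elim exE conjE) (rule that)
  define G' where "G' = G(?p := gp, l := gl, r := gr)"
  have G': "G' ?p = gp" "G' l = gl" "G' r = gr" "\<And>e. e \<noteq> ?p \<Longrightarrow> e \<noteq> l \<Longrightarrow> e \<noteq> r \<Longrightarrow> G' e = G e"
    using lr lrp by (auto simp: G'_def)
  have keep: "G' e = G e" if "e \<noteq> ?p" "G e \<noteq> None" for e
    using Pl Pr G' that by metis
  have Gll: "G' ll = G ll" if "G l = None" using keep ll that by blast
  have Grr: "G' rr = G rr" if "G r = None" using keep rr that by blast
  have "proper ?p G'"
    unfolding proper_def
  proof (intro allI impI)
    fix e assume e: "alive ?p e \<and> G' e = None"
    consider "e = ?p" | "e = l" | "e = r" | "e \<noteq> ?p" "e \<noteq> l" "e \<noteq> r" by blast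
    then show "\<not> anchored e \<and> e \<noteq> 0 \<and> e \<noteq> 1 \<and> (\<forall>b. nbr ?p e b \<longrightarrow> G' b \<noteq> None) \<and>
     (\<forall>b b'. nbr ?p e b \<longrightarrow> nbr ?p e b' \<longrightarrow> b \<noteq> b' \<longrightarrow> G' b \<noteq> G' b')"
    proof cases
      case 1
      have gp: "gp = None" using e 1 G' by simp
      then have "\<not> anchored ?p" using Pz by (auto simp: gz_def)
      then show ?thesis using 1 Pp[rule_format, OF gp] G'(1-3) lr(4) t by (metis One_nat_def Suc_inject nat.distinct(1) not_one_le_zero)
    next
      case 2
      have gl: "gl = None" "G l = None" using e 2 G'(2) Pl by auto
      have al: "alive t l" using e 2 lrp alive_stepD by auto
      have "G' b \<noteq> None" if "nbr ?p l b" for b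
        using ll(3)[OF gl(2) that] Pnl G'(1) gl Gll ll(4) by metis
      moreover have "G' b \<noteq> G' b'" if "nbr ?p l b" "nbr ?p l b'" "b \<noteq> b'" for b b'
        using ll(3)[OF gl(2) that(1)] ll(3)[OF gl(2) that(2)] that(3) Pnl G'(1) gl Gll by metis
      ultimately show ?thesis using okD(1-3)[OF al gl(2)] 2 by blast
    next
      case 3
      have gr: "gr = None" "G r = None" using e 3 G'(3) Pr by auto
      have al: "alive t r" using e 3 lrp alive_stepD by auto
      have "G' b \<noteq> None" if "nbr ?p r b" for b
        using rr(3)[OF gr(2) that] Pnr G'(1) gr Grr rr(4) by metis
      moreover have "G' b \<noteq> G' b'" if "nbr ?p r b" "nbr ?p r b'" "b \<noteq> b'" for b b'
        using rr(3)[OF gr(2) that(1)] rr(3)[OF gr(2) that(2)] that(3) Pnr G'(1) gr Grr by metis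
      ultimately show ?thesis using okD(1-3)[OF al gr(2)] 3 by blast
    next
      case 4
      have Ge: "G e = None" using e G' 4 by auto
      have al: "alive t e" using e 4 alive_stepD by auto
      have nb: "b \<noteq> ?p \<and> nbr t e b" if "nbr ?p e b" for b
      proof -
        have "b \<noteq> ?p" using that lr(4)[of e] 4 nbr_sym by blast
        then show ?thesis using old that 4 by blast
      qed
      have kb: "G' b = G b \<and> G b \<noteq> None" if "nbr ?p e b" for b
        using keep nb[OF that] okD(4)[OF al Ge] by blast
      show ?thesis using okD[OF al Ge] kb nb by metis
    qed
  qed
  moreover have "extends t G G'"
    unfolding extends_def
  proof (intro conjI allI impI)
    fix e assume "e \<noteq> ?p" "G e \<noteq> None" then show "G' e = G e" by (rule keep)
  next
    assume "anchored ?p" then show "G' ?p = Some (case G (anchor ?p) of Some b \<Rightarrow> b | None \<Rightarrow> True)"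
      using Pz G'(1) by (simp add: gz_def)
  next
    fix e b assume e: "e = ?p \<and> \<not> anchored e \<or> e \<noteq> ?p \<and> G e = None" and k: "G' e \<noteq> None" and nb: "nbr ?p e b"
    have "e = ?p \<or> e = l \<or> e = r" using e k G' by metis
    then consider "e = ?p" "\<not> anchored ?p" | "e = l" "G l = None" | "e = r" "G r = None"
      using e lrp by metis
    then show "G' b \<noteq> G' e"
    proof cases
      case 1 then show ?thesis using lr(4)[of b] nb Pd G'(1-3) k by metis
    next
      case 2 then show ?thesis using ll(3)[of b] Gll nb Pdl G'(1-3) k by metis
    next
      case 3 then show ?thesis using rr(3)[of b] Grr nb Pdr G'(1-3) k by metis
    qed
  next
    fix w assume w: "\<not> anchored ?p" "nbr ?p ?p w" "G w = None" "G' ?p = None \<and> G' w \<noteq> None"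
    then show "death ?p \<le> death w" using lr(4)[OF w(2)] Pkl Pkr G'(1-3) w by metis
  next
    fix w assume w: "\<not> anchored ?p" "nbr ?p ?p w" "G w = None" "G' w = None \<and> G' ?p \<noteq> None"
    then show "death w \<le> death ?p" using lr(4)[OF w(2)] Pkl Pkr G'(1-3) w by metis
  qed
  ultimately show ?thesis by blast
qed

lemma sequence_exists:
  "\<exists>g. (\<forall>t. 1 \<le> t \<longrightarrow> t < n \<longrightarrow> proper t (g t)) \<and>
       (\<forall>t. 1 \<le> t \<longrightarrow> Suc t < n \<longrightarrow> extends t (g t) (g (Suc t))) \<and> (\<exists>b. g 1 0 = Some b \<and> g 1 1 = Some (\<not> b))"
proof -
  \<comment> \<open>At time 1 exactly the two ends are present. The sequence \<open>h\<close> below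
    is shifted: \<open>h k\<close> belongs to time \<open>Suc k\<close>.\<close>
  define G0 where "G0 p = (if p = (0::nat) then Some True else Some False)" for p
  have p0: "proper 1 G0" by (auto simp: proper_def G0_def)
  let ?P = "\<lambda>k G. (k = 0 \<longrightarrow> G = G0) \<and> (Suc k < n \<longrightarrow> proper (Suc k) G)"
  let ?Q = "\<lambda>k G G'. Suc (Suc k) < n \<longrightarrow> extends (Suc k) G G'"
  have "\<exists>h. \<forall>k. ?P k (h k) \<and> ?Q k (h k) (h (Suc k))"
  proof (rule dependent_nat_choice)
    show "\<exists>G. ?P 0 G" using p0 by auto
    fix G k assume P: "?P k G"
    show "\<exists>G'. ?P (Suc k) G' \<and> ?Q k G G'"
    proof (cases "Suc (Suc k) < n")
      case True
      then show ?thesis using extension_exists[of "Suc k" G] P by auto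
    qed auto
  qed
  then obtain h where h: "\<And>k. ?P k (h k)" "\<And>k. ?Q k (h k) (h (Suc k))" by blast
  have "proper t (h (t - 1))" if "1 \<le> t" "t < n" for t using h(1)[of "t - 1"] that by simp
  moreover have "extends t (h (t - 1)) (h (Suc t - 1))" if "1 \<le> t" "Suc t < n" for t
    using h(2)[of "t - 1"] that by simp
  moreover have "h (1 - 1) 0 = Some True \<and> h (1 - 1) 1 = Some (\<not> True)" using h(1)[of 0] by (simp add: G0_def)
  ultimately show ?thesis by (intro exI[of _ "\<lambda>t. h (t - 1)"] conjI exI[of _ True]) auto
qed

end

text \<open>For an anchored point, \<open>state\<close> is the colour shown to the neighbours, not its own colour.\<close>

locale coloured = staircase +
  fixes state :: "nat \<Rightarrow> nat \<Rightarrow> bool option"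
  assumes state_proper: "\<lbrakk>1 \<le> t; t < n\<rbrakk> \<Longrightarrow> proper t (state t)"
    and state_extends: "\<lbrakk>1 \<le> t; Suc t < n\<rbrakk> \<Longrightarrow> extends t (state t) (state (Suc t))"
    and state_start: "state 1 0 \<noteq> None" "state 1 1 \<noteq> None" "state 1 0 \<noteq> state 1 1"
begin

text \<open>The recursion follows killers and so runs towards later arrivals.
  \<open>death p - 1\<close> is the last moment in the life of \<open>p\<close>; \<open>True\<close>
  is an arbitrary choice for anchored or undecided points that are never removed.\<close>

function colour :: "nat \<Rightarrow> bool" where
  "colour p = (if \<not> anchored p \<and> state (death p - 1) p \<noteq> None then the (state (death p - 1) p)
          else if death p < n then \<not> colour (death p) else True)"
  by pat_completeness auto
termination
  by (relation "Wellfounded.measure (\<lambda>p. n - p)") (use death_props(1) in \<open>auto intro!: diff_less_mono2 intro: less_trans\<close>)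

declare colour.simps [simp del]

section \<open>Persistence of decisions and contrast between neighbours\<close>

lemma state_keep:
  assumes "1 \<le> s" "e \<le> s" "s \<le> t" "t < n" "state s e \<noteq> None" shows "state t e = state s e"
  using assms(3,4)
proof (induction t rule: dec_induct)
  case (step t)
  then show ?case using state_extends[of t] assms unfolding extends_def by auto
qed simp

lemma state_fresh:
  assumes "1 \<le> t" "Suc t < n" "e = Suc t \<and> \<not> anchored e \<or> e \<noteq> Suc t \<and> state t e = None"
    "state (Suc t) e \<noteq> None" "nbr (Suc t) e b"
  shows "state (Suc t) b \<noteq> state (Suc t) e"
  using state_extends[OF assms(1,2)] assms(3-) unfolding extends_def by blast

lemma state_anchored:
  assumes "anchored z" "2 \<le> z" "z \<le> t" "t < n"
  shows "state t z = Some (case state (z - 1) (anchor z) of Some b \<Rightarrow> b | None \<Rightarrow> True)"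
proof -
  have "state z z = Some (case state (z - 1) (anchor z) of Some b \<Rightarrow> b | None \<Rightarrow> True)"
    using state_extends[of "z - 1"] assms unfolding extends_def by auto
  then show ?thesis using state_keep[of z z t] assms by auto
qed

lemma state_undecided:
  assumes "1 \<le> t" "t < n" "alive t e" "state t e = None"
  shows "\<not> anchored e" "e \<noteq> 0" "e \<noteq> 1" "nbr t e b \<Longrightarrow> state t b \<noteq> None"
    "nbr t e b \<Longrightarrow> nbr t e b' \<Longrightarrow> b \<noteq> b' \<Longrightarrow> state t b \<noteq> state t b'"
  using state_proper[OF assms(1,2)] assms(3,4) unfolding proper_def by metis+

lemma colour_decided:
  assumes "\<not> anchored e" "alive t e" "1 \<le> t" "t < n" "state t e = Some k" shows "colour e = k"
proof -
  have e: "e < n" "t < death e" using assms by (auto simp: alive_def)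
  have "death e \<le> n" using death_props(3) e by auto
  then have "state (death e - 1) e = Some k" using state_keep[of t e "death e - 1"] assms e by (auto simp: alive_def)
  then show ?thesis using assms by (subst colour.simps) simp
qed

text \<open>Whichever of the two states was decided last was chosen against the other. The final
  hypothesis excludes the one exception: an anchored \<open>b\<close> arriving next to an already
  decided \<open>e\<close>, where the anchor of \<open>b\<close> dictates the colour shown.\<close>

lemma nbr_differ:
  assumes "1 \<le> t" "t < n" "nbr t e b" "\<not> anchored e" "state t e \<noteq> None"
    "\<not> anchored b \<or> b < e \<or> state (b - 1) e = None"
  shows "state t b \<noteq> state t e"
  using assms
proof (induction t arbitrary: e b rule: dec_induct)
  case base
  have "e \<in> {0, 1}" "b \<in> {0, 1}" "e \<noteq> b" using base by (auto simp: nbr_def alive_def)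
  then show ?case using state_start by auto
next
  case (step t)
  have t: "1 \<le> t" "Suc t < n" "t < n" using step by auto
  have eb: "alive (Suc t) e" "alive (Suc t) b" using step.prems nbr_alive by blast+
  have be: "nbr (Suc t) b e" using step.prems nbr_sym by blast
  show ?case
  proof (cases "e = Suc t \<or> state t e = None")
    case True
    then show ?thesis using state_fresh[OF t(1,2) _ step.prems(4), of b] step.prems by blast
  next
    case False
    then have ge: "state (Suc t) e = state t e" using state_keep[of t e "Suc t"] eb t by (auto simp: alive_def)
    show ?thesis
    proof (cases "b = Suc t")
      case True
      then have "\<not> anchored b" using step.prems(5) False eb by (auto simp: alive_def)
      then show ?thesis using state_fresh[OF t(1,2) _ _ be] True step.prems(4) by metis
    next
      case bt: False
      have nb: "nbr t e b"
        using nbr_history[OF step.prems(2), of t] alive_stepD eb bt False t by auto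
      show ?thesis
      proof (cases "state t b = None")
        case True
        then show ?thesis using state_fresh[OF t(1,2) _ _ be] bt step.prems(4) by metis
      next
        case gb: False
        then have "state (Suc t) b = state t b" using state_keep[of t b "Suc t"] eb bt t by (auto simp: alive_def)
        then show ?thesis using step.IH[OF t(3) nb step.prems(3)] step.prems(5) ge False by auto
      qed
    qed
  qed
qed

end

section \<open>Monochromatic octants\<close>

text \<open>\<open>X\<close> is the only colour occurring in the octant \<open>S\<close>; the bounds
  on \<open>a\<close> and \<open>b\<close> keep the two artificial ends outside.\<close>

locale mono_octant = coloured +
  fixes a b :: real and T :: nat and X :: bool and S :: "nat set"
  assumes T: "T < n" and a: "a \<le> x 1" and b: "b \<le> y 0"
    and S_def: "S = {e. e \<le> T \<and> x e < a \<and> y e < b}"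
    and mono: "e \<in> S \<Longrightarrow> colour e = X"
begin

text \<open>A seal stays at one end of the part of the staircase inside the octant for ever.\<close>

definition seal :: "nat \<Rightarrow> bool" where
  "seal s \<longleftrightarrow> s \<in> S \<and> anchored s \<and> anchor s \<notin> S"

lemma mem_S: "e \<in> S \<longleftrightarrow> e \<le> T \<and> x e < a \<and> y e < b"
  by (simp add: S_def)

lemma S_D: "e \<in> S \<Longrightarrow> e \<le> T" "e \<in> S \<Longrightarrow> e < n" "e \<in> S \<Longrightarrow> x e < a" "e \<in> S \<Longrightarrow> y e < b"
  using T by (auto simp: mem_S)

lemma S_ge2: "e \<in> S \<Longrightarrow> 2 \<le> e"
proof -
  assume e: "e \<in> S"
  have "e \<noteq> 0" using S_D(4)[OF e] b by (metis not_le)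
  moreover have "e \<noteq> 1" using S_D(3)[OF e] a by (metis not_le)
  ultimately show ?thesis by linarith
qed

lemma finite_S: "finite S" by (rule finite_subset[of _ "{..T}"]) (auto simp: mem_S)

lemma S_below: "e \<in> S \<Longrightarrow> below q e \<Longrightarrow> q \<le> T \<Longrightarrow> q \<in> S"
  by (auto simp: mem_S below_def)

lemma S_killer: "e \<in> S \<Longrightarrow> death e \<le> T \<Longrightarrow> death e \<in> S"
  using S_below death_props(2) T by auto

text \<open>The octant is closed downwards, so it also contains the killer. Equal colours of victim
  and killer exclude both situations in which \<open>colour\<close> takes the opposite of the
  killer.\<close>

lemma dead:
  assumes "e \<in> S" "death e \<le> T" shows "\<not> anchored e" "state (death e - 1) e = Some X"
proof -
  have ne: "colour e = colour (death e)" using mono S_killer assms by auto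
  have dn: "death e < n" using assms T by auto
  show nz: "\<not> anchored e" using ne dn by (subst (asm) colour.simps) auto
  show "state (death e - 1) e = Some X"
  proof (cases "state (death e - 1) e")
    case None
    then show ?thesis using ne dn by (subst (asm) colour.simps) auto
  next
    case (Some k)
    then have "colour e = k" using nz by (subst colour.simps) auto
    then show ?thesis using Some mono assms by auto
  qed
qed

lemma anchored_alive: "e \<in> S \<Longrightarrow> anchored e \<Longrightarrow> e \<le> t \<Longrightarrow> t \<le> T \<Longrightarrow> alive t e"
  using dead(1)[of e] by (cases "death e \<le> T") (auto simp: alive_def)

lemma anchored_decided: "e \<in> S \<Longrightarrow> anchored e \<Longrightarrow> e \<le> t \<Longrightarrow> t \<le> T \<Longrightarrow> state t e \<noteq> None"
  using state_anchored[of e t] S_ge2 T by auto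

text \<open>An unanchored point shows its own final colour. An unsealed anchored one shows the
  colour of its anchor, a removed point of \<open>S\<close>, to which \<open>dead\<close>
  applies.\<close>

lemma display:
  assumes "e \<in> S" "\<not> seal e" "alive t e" "t \<le> T" "state t e \<noteq> None" shows "state t e = Some X"
proof (cases "anchored e")
  case False
  then show ?thesis using colour_decided[of e t] assms mono S_ge2[of e] T by (auto simp: alive_def)
next
  case True
  then have vS: "anchor e \<in> S" using assms by (auto simp: seal_def)
  have "death (anchor e) = e" using anchor_props True by auto
  then have "state (e - 1) (anchor e) = Some X" using dead(2)[OF vS] S_D assms by auto
  then show ?thesis using state_anchored[OF True, of t] S_ge2 assms T by (auto simp: alive_def)
qed

section \<open>Position of points and seals along the octant\<close>

lemma between_S:
  assumes "e1 \<in> S" "e2 \<in> S" "alive t e1" "alive t e2" "alive t m" "btw e1 m e2" "t \<le> T"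
  shows "m \<in> S"
proof -
  have t: "t < n" using assms T by auto
  have *: "m \<in> S" if "e1 \<in> S" "e2 \<in> S" "alive t e1" "alive t e2" "x e1 < x m" "x m < x e2" for e1 e2
    using S_D[OF that(1)] S_D[OF that(2)] alive_xy[OF that(3) assms(5) t] that assms(5,7)
    by (auto simp: mem_S alive_def)
  show ?thesis using *[OF assms(1-4)] *[OF assms(2,1,4,3)] assms(6) by (auto simp: btw_def)
qed

text \<open>A point of \<open>S\<close> to the left of \<open>s\<close> would lie below the anchor,
  whose \<open>y\<close> is too large for \<open>S\<close>. If older than \<open>s\<close>, it would
  have been alive together with the anchor; if younger, it contradicts
  \<open>narrow\<close>.\<close>

lemma seal_extreme_left:
  assumes "seal s" "\<not> y (anchor s) < b" "e \<in> S" "alive t e" "alive t s" "t \<le> T"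
  shows "x s \<le> x e"
proof (rule ccontr)
  assume "\<not> x s \<le> x e"
  moreover have vs: "death (anchor s) = s" "narrow (anchor s)" "anchor s < s" using anchor_props assms by (auto simp: seal_def)
  moreover have bl: "below s (anchor s)" using death_props(2)[of "anchor s"] vs assms S_D by (auto simp: seal_def)
  ultimately have be: "below e (anchor s)" using S_D(4)[OF assms(3)] assms(2) by (auto simp: below_def)
  have sT: "s < n" "2 \<le> s" using assms S_D S_ge2 by (auto simp: seal_def)
  consider "e < s" | "e = s" | "s < e" by linarith
  then show False
  proof cases
    case 1
    then have "alive (s - 1) e" "alive (s - 1) (anchor s)"
      using assms vs by (auto simp: alive_def)
    then show False using alive_antichain[of "s - 1"] be sT by auto
  next
    case 2 then show False using \<open>\<not> x s \<le> x e\<close> by simp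
  next
    case 3
    then show False using be vs assms by (auto simp: narrow_def alive_def)
  qed
qed

lemma seal_extreme_right:
  assumes "seal s" "\<not> x (anchor s) < a" "e \<in> S" "alive t e" "alive t s" "t \<le> T"
  shows "x e \<le> x s"
proof (rule ccontr)
  assume ns: "\<not> x e \<le> x s"
  then have ys: "y e < y s" using alive_xy[OF assms(5,4)] assms T by auto
  moreover have vs: "death (anchor s) = s" "narrow (anchor s)" "anchor s < s" using anchor_props assms by (auto simp: seal_def)
  moreover have bl: "below s (anchor s)" using death_props(2)[of "anchor s"] vs assms S_D by (auto simp: seal_def)
  ultimately have be: "below e (anchor s)" using S_D(3)[OF assms(3)] assms(2) by (auto simp: below_def)
  have sT: "s < n" "2 \<le> s" using assms S_D S_ge2 by (auto simp: seal_def)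
  consider "e < s" | "e = s" | "s < e" by linarith
  then show False
  proof cases
    case 1
    then have "alive (s - 1) e" "alive (s - 1) (anchor s)"
      using assms vs by (auto simp: alive_def)
    then show False using alive_antichain[of "s - 1"] be sT by auto
  next
    case 2 then show False using ns by simp
  next
    case 3
    then show False using be vs assms by (auto simp: narrow_def alive_def)
  qed
qed

lemma seal_cases: "seal s \<Longrightarrow> \<not> x (anchor s) < a \<or> \<not> y (anchor s) < b"
  using anchor_props(4)[of s] S_D(1)[of s] by (auto simp: seal_def mem_S)

lemma between_no_seal:
  assumes "e1 \<in> S" "e2 \<in> S" "alive t e1" "alive t e2" "alive t m" "btw e1 m e2" "t \<le> T"
  shows "\<not> seal m"
proof
  assume m: "seal m"
  show False
    using seal_cases[OF m] seal_extreme_left[OF m _ assms(1,3,5,7)] seal_extreme_left[OF m _ assms(2,4,5,7)]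
      seal_extreme_right[OF m _ assms(1,3,5,7)] seal_extreme_right[OF m _ assms(2,4,5,7)] assms(6)
    unfolding btw_def by linarith
qed

section \<open>Adjacent points of the octant\<close>

lemma anchored_nbr_victim:
  assumes "anchored z" "z \<in> S" "\<not> seal z" "nbr z s z" "s \<in> S"
  shows "nbr (z - 1) s (anchor z)" "state (z - 1) (anchor z) = Some X"
proof -
  have vS: "anchor z \<in> S" using assms by (auto simp: seal_def)
  have vz: "death (anchor z) = z" "\<not> anchored (anchor z)" "anchor z < z" using anchor_props assms by auto
  have "2 \<le> z" "z \<le> T" "z < n" using S_ge2 S_D assms by auto
  then have z2: "2 \<le> z" "z \<le> T" "z < n" "1 \<le> z - 1" "z - 1 < n" "z - 1 \<le> T" by auto
  then have Sz: "z = Suc (z - 1)" by simp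
  show gv: "state (z - 1) (anchor z) = Some X" using dead[OF vS] vz z2 by auto
  have al: "alive (z - 1) (anchor z)" using vz z2 by (auto simp: alive_def)
  have sz: "alive z s" "s \<noteq> z" using assms nbr_alive by blast+
  then have als: "alive (z - 1) s" by (auto simp: alive_def)
  have "s \<noteq> anchor z" using sz vz by (auto simp: alive_def)
  then obtain m where m: "nbr (z - 1) m (anchor z)" "m = s \<or> btw s m (anchor z)"
    using nearest[OF als al _ z2(5)] by blast
  \<comment> \<open>Otherwise the neighbour \<open>m\<close> of the anchor would be another point of
    \<open>S\<close> removed by \<open>z\<close>, and two adjacent unanchored points would both show
    \<open>X\<close>.\<close>
  have "m = s"
  proof (rule ccontr)
    assume "m \<noteq> s"
    then have bt: "btw s m (anchor z)" using m by auto
    have am: "alive (z - 1) m" using m nbr_alive by blast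
    have dm: "death m = z"
      using removed_between[of "z - 1" s "anchor z" m] assms(4) bt am al vz z2 Sz by auto
    have "m \<in> S" using between_S[OF assms(5) vS als al am bt] z2 by auto
    from dead[OF this] dm z2 have "\<not> anchored m" "state (z - 1) m = Some X" by auto
    then show False using nbr_differ[OF _ _ m(1)] z2 vz gv by auto
  qed
  then show "nbr (z - 1) s (anchor z)" using m by simp
qed

text \<open>Had \<open>s\<close> been decided before \<open>z\<close> came, it would have shown
  \<open>X\<close> next to the anchor of \<open>z\<close>, which also showed \<open>X\<close>. Had
  it been decided on the arrival of \<open>z\<close>, it would have avoided the colour
  \<open>X\<close> shown by \<open>z\<close>.\<close>

lemma anchored_nbr_undecided:
  assumes "anchored z" "z \<in> S" "\<not> seal z" "nbr z s z" "s \<in> S" "\<not> anchored s"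
  shows "state z s = None"
proof (rule ccontr)
  assume some: "state z s \<noteq> None"
  have "2 \<le> z" "z \<le> T" "z < n" using S_ge2 S_D assms by auto
  then have z2: "2 \<le> z" "z \<le> T" "z < n" "1 \<le> z - 1" "z - 1 < n" "z - 1 \<le> T" by auto
  have sz: "alive z s" "s \<noteq> z" using assms nbr_alive by blast+
  then have als: "alive (z - 1) s" by (auto simp: alive_def)
  have ns: "\<not> seal s" using assms by (auto simp: seal_def)
  note vic = anchored_nbr_victim[OF assms(1-5)]
  have "state (z - 1) s = None"
  proof (rule ccontr)
    assume "state (z - 1) s \<noteq> None"
    then have "state (z - 1) s = Some X" using display[OF assms(5) ns als] z2 by auto
    then show False using nbr_differ[OF _ _ vic(1)] vic(2) z2 assms(6) anchor_props(3)[OF assms(1)] by auto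
  qed
  then have "state z z \<noteq> state z s"
    using state_fresh[of "z - 1" s z] some sz assms(4) z2 by auto
  moreover have "state z s = Some X" using display[OF assms(5) ns sz(1) z2(2) some] .
  moreover have "state z z = Some X" using display[OF assms(2,3)] anchored_decided assms z2 by auto
  ultimately show False by simp
qed

text \<open>An anchored \<open>s\<close> would show \<open>X\<close> next to the anchor of
  \<open>z\<close>, which shows \<open>X\<close> too. By \<open>nbr_differ\<close> that anchor was
  decided before \<open>s\<close> arrived, which \<open>anchored_nbr_undecided\<close>, applied to
  \<open>s\<close>, forbids.\<close>

lemma anchored_nbr_not_anchored:
  assumes "anchored z" "z \<in> S" "\<not> seal z" "nbr z s z" "s \<in> S" "\<not> seal s"
  shows "\<not> anchored s"
proof
  assume Zs: "anchored s"
  have "2 \<le> z" "z \<le> T" "z < n" using S_ge2 S_D assms by auto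
  then have z2: "2 \<le> z" "z \<le> T" "z < n" "1 \<le> z - 1" "z - 1 < n" "z - 1 \<le> T" by auto
  have sz: "alive z s" "s \<noteq> z" using assms nbr_alive by blast+
  then have als: "alive (z - 1) s" "s \<le> z - 1" by (auto simp: alive_def)
  note vic = anchored_nbr_victim[OF assms(1-5)]
  have vS: "anchor z \<in> S" using assms by (auto simp: seal_def)
  have vz: "\<not> anchored (anchor z)" using anchor_props assms by auto
  have gs: "state (z - 1) s = Some X"
    using display[OF assms(5,6) als(1)] anchored_decided[OF assms(5) Zs als(2)] z2 by auto
  have nb: "nbr (z - 1) (anchor z) s" using vic nbr_sym by blast
  have nd: "\<not> (s < anchor z)" "state (s - 1) (anchor z) \<noteq> None"
    using nbr_differ[OF _ _ nb vz] vic(2) gs z2 by auto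
  have "s \<noteq> anchor z" using nb nbr_alive by blast
  then have lt: "anchor z < s" using nd by auto
  have s2: "2 \<le> s" "s \<le> T" using S_ge2 S_D assms by auto
  have "nbr s (anchor z) s"
    using nbr_history[OF nb, of s] alive_mono[OF nbr_alive(1)[OF nb], of s] lt als z2 by auto
  then have "state s (anchor z) = None" using anchored_nbr_undecided[OF Zs assms(5,6) _ vS vz] by auto
  then have "state (s - 1) (anchor z) = None"
    using state_keep[of "s - 1" "anchor z" s] s2 lt T by force
  then show False using nd by simp
qed

text \<open>Two decided neighbours would both show \<open>X\<close>, against
  \<open>nbr_differ\<close>. If the younger one is anchored, the preceding lemmas supply the
  hypothesis: the older one was still undecided when it arrived.\<close>

lemma nbrs_undecided:
  assumes "nbr t p q" "p \<in> S" "q \<in> S" "\<not> seal p" "\<not> seal q" "t \<le> T"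
  shows "state t p = None \<or> state t q = None"
proof -
  have *: False if pq: "nbr t p q" "p \<in> S" "q \<in> S" "\<not> seal p" "\<not> seal q" "p < q"
    and some: "state t p \<noteq> None" "state t q \<noteq> None" for p q
  proof -
    have al: "alive t p" "alive t q" using nbr_alive pq by blast+
    have t: "1 \<le> t" "t < n" "q \<le> t" using al S_ge2[OF pq(3)] assms T by (auto simp: alive_def)
    have X: "state t p = Some X" "state t q = Some X"
      using display[OF pq(2,4) al(1) assms(6) some(1)] display[OF pq(3,5) al(2) assms(6) some(2)] .
    have qp: "nbr t q p" using pq nbr_sym by blast
    show False
    proof (cases "anchored q")
      case False
      then show False using nbr_differ[OF t(1,2) qp False some(2)] pq(6) X by auto
    next
      case True
      have nq: "nbr q p q" using nbr_history[OF pq(1) alive_mono[OF al(1)], of q] t pq(6) by auto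
      have nz: "\<not> anchored p" using anchored_nbr_not_anchored[OF True pq(3,5) nq pq(2,4)] .
      have "state q p = None" using anchored_nbr_undecided[OF True pq(3,5) nq pq(2) nz] .
      then have "state (q - 1) p = None"
        using state_keep[of "q - 1" p q] S_ge2[OF pq(3)] pq(6) S_D[OF pq(3)] T by force
      then show False using nbr_differ[OF t(1,2) pq(1) nz some(1)] X by auto
    qed
  qed
  have "p \<noteq> q" using assms nbr_alive by blast
  then consider "p < q" | "q < p" by linarith
  then show ?thesis
  proof cases
    case 1 then show ?thesis using *[OF assms(1-5)] by blast
  next
    case 2 then show ?thesis using *[OF _ assms(3,2,5,4)] assms(1) nbr_sym by blast
  qed
qed

text \<open>Both neighbours of \<open>u\<close> would be decided unsealed points of
  \<open>S\<close>, hence show \<open>X\<close>, whereas an undecided point separates different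
  colours.\<close>

lemma undecided_not_between:
  assumes "u \<in> S" "alive t u" "state t u = None" "e1 \<in> S" "e2 \<in> S" "alive t e1" "alive t e2"
    "x e1 < x u" "x u < x e2" "\<not> seal e1" "\<not> seal e2" "t \<le> T"
  shows False
proof -
  have t: "1 \<le> t" "t < n" using assms S_ge2[OF assms(1)] T by (auto simp: alive_def)
  obtain m1 where m1: "nbr t m1 u" "m1 = e1 \<or> btw e1 m1 u"
    using nearest[of t e1 u] assms t by auto
  obtain m2 where m2: "nbr t m2 u" "m2 = e2 \<or> btw e2 m2 u"
    using nearest[of t e2 u] assms t by auto
  have al: "alive t m1" "alive t m2" using m1 m2 nbr_alive by blast+
  have b1: "m1 = e1 \<or> btw e1 m1 e2" and b2: "m2 = e2 \<or> btw e1 m2 e2"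
    using m1 m2 assms(8,9) by (auto simp: btw_def)
  have S1: "m1 \<in> S" "\<not> seal m1"
    using b1 between_S[OF assms(4-7) al(1)] between_no_seal[OF assms(4-7) al(1)] assms by blast+
  have S2: "m2 \<in> S" "\<not> seal m2"
    using b2 between_S[OF assms(4-7) al(2)] between_no_seal[OF assms(4-7) al(2)] assms by blast+
  have ne: "m1 \<noteq> m2" using m1 m2 assms(8,9) by (auto simp: btw_def)
  have n: "nbr t u m1" "nbr t u m2" using m1 m2 nbr_sym by blast+
  note und = state_undecided[OF t assms(2,3)]
  have "state t m1 = Some X" "state t m2 = Some X"
    using display S1 S2 al assms(12) und(4) n by blast+
  then show False using und(5)[OF n ne] by simp
qed

text \<open>Walking from one decided point to the other, the first point met is undecided by
  \<open>nbrs_undecided\<close> and lies strictly between the two.\<close>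

lemma decided_unique:
  assumes "o1 \<in> S" "o2 \<in> S" "alive t o1" "alive t o2" "\<not> seal o1" "\<not> seal o2"
    "state t o1 \<noteq> None" "state t o2 \<noteq> None" "t \<le> T"
  shows "o1 = o2"
proof (rule ccontr)
  assume ne: "o1 \<noteq> o2"
  have t: "t < n" using assms T by auto
  obtain m where m: "nbr t m o1" "m = o2 \<or> btw o2 m o1" using nearest[of t o2 o1] assms ne t by auto
  have am: "alive t m" using m nbr_alive by blast
  have Sm: "m \<in> S" "\<not> seal m"
    using m between_S[OF assms(2,1,4,3) am] between_no_seal[OF assms(2,1,4,3) am] assms by blast+
  have gm: "state t m = None" using nbrs_undecided[OF m(1) Sm(1) assms(1) Sm(2) assms(5,9)] assms(7) by blast
  then have "btw o2 m o1" using m assms by auto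
  then consider "x o1 < x m" "x m < x o2" | "x o2 < x m" "x m < x o1" by (auto simp: btw_def)
  then show False
    using undecided_not_between[OF Sm(1) am gm] assms by cases blast+
qed

end

lemma three_elements:
  fixes f :: "nat \<Rightarrow> real"
  assumes "finite U" "3 \<le> card U" "inj_on f U"
  shows "\<exists>u1\<in>U. \<exists>u2\<in>U. \<exists>u3\<in>U. f u1 < f u2 \<and> f u2 < f u3"
proof -
  obtain p q r where U: "p \<in> U" "q \<in> U" "r \<in> U" and ne: "p \<noteq> q" "q \<noteq> r" "p \<noteq> r"
    using assms(2) obtain_subset_with_card_n[of 3 U] card_3_iff by (metis insert_subset)
  then have "f p \<noteq> f q" "f q \<noteq> f r" "f p \<noteq> f r" using assms(3) by (auto simp: inj_on_def)
  then consider "f p < f q" "f q < f r" | "f p < f r" "f r < f q" | "f q < f p" "f p < f r"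
    | "f q < f r" "f r < f p" | "f r < f p" "f p < f q" | "f r < f q" "f q < f p"
    by linarith
  then show ?thesis using U by cases blast+
qed

section \<open>Counting the points of a monochromatic octant\<close>

context mono_octant begin

definition killers :: "nat set" where
  "killers = {q \<in> S. \<exists>e\<in>S. death e = q}"

lemma inj_x_S: "A \<subseteq> S \<Longrightarrow> inj_on x A"
  by (rule inj_on_subset[OF inj_x]) (auto dest: S_D(2))

text \<open>Seals are anchored, so all of them are alive at time \<open>T\<close>. There each is the
  leftmost or rightmost point of the octant, according to the bound that its anchor
  violates.\<close>

lemma card_seals: "card {s. seal s} \<le> 2"
proof -
  let ?L = "{s. seal s \<and> \<not> y (anchor s) < b}" and ?R = "{s. seal s \<and> \<not> x (anchor s) < a}"
  have sub: "{s. seal s} \<subseteq> S" by (auto simp: seal_def)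
  have al: "alive T s" "s \<in> S" if "seal s" for s
    using that anchored_alive[of s T] S_D by (auto simp: seal_def)
  have eq: "s = s'" if "seal s" "seal s'" "x s \<le> x s'" "x s' \<le> x s" for s s'
    using inj_onD[OF inj_x_S[OF sub], of s s'] that by auto
  have L: "card ?L \<le> 1"
  proof (rule card_le_Suc0_iff_eq[THEN iffD2, simplified One_nat_def[symmetric]])
    show "finite ?L" by (rule finite_subset[OF _ finite_S]) (auto simp: seal_def)
    show "\<forall>s\<in>?L. \<forall>s'\<in>?L. s = s'"
      using eq seal_extreme_left[OF _ _ al(2) al(1) al(1) order_refl] by blast
  qed
  have R: "card ?R \<le> 1"
  proof (rule card_le_Suc0_iff_eq[THEN iffD2, simplified One_nat_def[symmetric]])
    show "finite ?R" by (rule finite_subset[OF _ finite_S]) (auto simp: seal_def)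
    show "\<forall>s\<in>?R. \<forall>s'\<in>?R. s = s'"
      using eq seal_extreme_right[OF _ _ al(2) al(1) al(1) order_refl] by blast
  qed
  have "{s. seal s} = ?L \<union> ?R" using seal_cases by auto
  then have "card {s. seal s} = card (?L \<union> ?R)" by (rule arg_cong)
  also have "\<dots> \<le> card ?L + card ?R" by (rule card_Un_le)
  finally have "card {s. seal s} \<le> card ?L + card ?R" .
  then show ?thesis using L R by linarith
qed

text \<open>One decided point and two undecided ones: the middle one of three undecided points would
  contradict \<open>undecided_not_between\<close>.\<close>

lemma card_unsealed:
  assumes "t \<le> T" shows "card {e \<in> S. alive t e \<and> \<not> seal e} \<le> 3"
proof -
  let ?M = "{e \<in> S. alive t e \<and> \<not> seal e}"
  let ?U = "{e \<in> ?M. state t e = None}" and ?C = "{e \<in> ?M. state t e \<noteq> None}"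
  have fin: "finite ?M" using finite_S by auto
  have C: "card ?C \<le> 1"
  proof (rule card_le_Suc0_iff_eq[THEN iffD2, simplified One_nat_def[symmetric]])
    show "\<forall>s\<in>?C. \<forall>s'\<in>?C. s = s'" using decided_unique[of _ _ t] assms by blast
    show "finite ?C" using fin by (rule rev_finite_subset) blast
  qed
  have U: "card ?U \<le> 2"
  proof (rule ccontr)
    assume "\<not> card ?U \<le> 2"
    then have "3 \<le> card ?U" by simp
    moreover have "finite ?U" using fin by (rule rev_finite_subset) blast
    moreover have "inj_on x ?U" by (rule inj_x_S) blast
    ultimately obtain u1 u2 u3 where "u1 \<in> ?U" "u2 \<in> ?U" "u3 \<in> ?U" "x u1 < x u2" "x u2 < x u3"
      using three_elements[of ?U x] by blast
    then show False using undecided_not_between[of u2 t u1 u3] assms by auto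
  qed
  have "?M = ?U \<union> ?C" by auto
  then have "card ?M = card (?U \<union> ?C)" by (rule arg_cong)
  also have "\<dots> \<le> card ?U + card ?C" by (rule card_Un_le)
  finally have "card ?M \<le> card ?U + card ?C" .
  then show ?thesis using U C by linarith
qed

lemma card_alive: "card {e \<in> S. alive T e} \<le> 5"
proof -
  let ?M = "{e \<in> S. alive T e \<and> \<not> seal e}"
  have "{e \<in> S. alive T e} \<subseteq> ?M \<union> {s. seal s}" by auto
  then have "card {e \<in> S. alive T e} \<le> card (?M \<union> {s. seal s})"
    by (intro card_mono) (use finite_S in \<open>auto simp: seal_def intro: finite_subset\<close>)
  also have "\<dots> \<le> card ?M + card {s. seal s}" by (rule card_Un_le)
  finally show ?thesis using card_unsealed[of T] card_seals by linarith
qed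

lemma victim:
  assumes "e \<in> S" "death e = q" "q \<le> T"
  shows "alive (q - 1) e" "\<not> anchored e" "\<not> seal e" "state (q - 1) e = Some X" "1 \<le> q - 1" "q - 1 < q" "e < q"
proof -
  have eq: "e < q" using death_props(1)[of e] assms by auto
  then show "1 \<le> q - 1" "q - 1 < q" "e < q" using S_ge2[OF assms(1)] by auto
  show "alive (q - 1) e" using eq assms by (auto simp: alive_def)
  show "\<not> anchored e" "state (q - 1) e = Some X" using dead[OF assms(1)] assms by auto
  then show "\<not> seal e" by (auto simp: seal_def)
qed

text \<open>Just before its removal a victim is decided and unsealed, and
  \<open>decided_unique\<close> allows only one such point.\<close>

lemma victim_unique:
  assumes "e \<in> S" "e' \<in> S" "death e = death e'" "death e \<le> T" shows "e = e'"
  using decided_unique[of e e' "death e - 1"] victim[OF assms(1) refl assms(4)]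
    victim[OF assms(2) assms(3)[symmetric]] assms by auto

text \<open>Removed points are charged to their killers, injectively by
  \<open>victim_unique\<close>.\<close>

lemma card_S: "card S \<le> 5 + card killers"
proof -
  let ?D = "{e \<in> S. death e \<le> T}"
  have "S = {e \<in> S. alive T e} \<union> ?D" using S_D by (auto simp: alive_def)
  then have "card S = card ({e \<in> S. alive T e} \<union> ?D)" by (rule arg_cong)
  also have "\<dots> \<le> card {e \<in> S. alive T e} + card ?D" by (rule card_Un_le)
  finally have "card S \<le> card {e \<in> S. alive T e} + card ?D" .
  moreover have "card ?D \<le> card killers"
  proof (rule card_inj_on_le)
    show "inj_on death ?D" by (rule inj_onI) (use victim_unique in auto)
    show "death ` ?D \<subseteq> killers" using S_killer by (auto simp: killers_def)
    show "finite killers" using finite_S by (auto simp: killers_def)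
  qed
  ultimately show ?thesis using card_alive by linarith
qed

text \<open>When the victim has an unsealed companion, the companion is undecided. The killer and the
  companion then form a pair one of which stays undecided and cannot die first, so neither of them
  ever dies and the octant gains no further victim.\<close>

lemma no_later_killer:
  assumes q: "q \<in> S" "\<not> seal q" and e: "e \<in> S" "death e = q"
    and w: "w \<in> S" "alive (q - 1) w" "\<not> seal w" "w \<noteq> e"
    and r: "q < r" "r \<le> T" "f \<in> S" "death f = r"
  shows False
proof -
  have qT: "q \<le> T" "q < n" using S_D q by auto
  note ve = victim[OF e qT(1)]
  have q1: "q - 1 < n" "q - 1 \<le> T" "q = Suc (q - 1)" using ve qT by auto
  \<comment> \<open>\<open>e\<close> is already the only decided unsealed point.\<close>
  have gw: "state (q - 1) w = None"
    using decided_unique[OF w(1) e(1) w(2) ve(1) w(3) ve(3) _ _ q1(2)] ve(4) w(4) by force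
  note und = state_undecided[OF ve(5) q1(1) w(2) gw]
  have wq: "w \<noteq> q" "w < q" using w(2) ve(6) by (auto simp: alive_def)
  have dw: "death w \<noteq> q" using victim_unique[OF w(1) e(1)] w e qT by auto
  then have aw: "alive q w" using w(2) q1(3) ve(6) by (auto simp: alive_def)
  \<comment> \<open>The neighbour of \<open>w\<close> towards \<open>e\<close> is decided because
    \<open>w\<close> is not, so it can only be \<open>e\<close>.\<close>
  have nwe: "nbr (q - 1) e w"
  proof -
    obtain m where m: "nbr (q - 1) m w" "m = e \<or> btw e m w"
      using nearest[OF ve(1) w(2) w(4)[symmetric] q1(1)] by auto
    have am: "alive (q - 1) m" using m nbr_alive by blast
    have gm: "state (q - 1) m \<noteq> None" using und(4) m(1) nbr_sym by blast
    have "m \<in> S \<and> \<not> seal m"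
      using m(2) between_S[OF e(1) w(1) ve(1) w(2) am] between_no_seal[OF e(1) w(1) ve(1) w(2) am] ve(3) e q1 by blast
    then have "m = e" using decided_unique[OF _ e(1) am ve(1) _ ve(3) gm] ve(4) q1 by auto
    then show ?thesis using m by simp
  qed
  have bl: "below q e" using death_props(2)[of e] e qT by auto
  \<comment> \<open>\<open>q\<close> takes the place of \<open>e\<close> next to \<open>w\<close>: a
    point between \<open>q\<close> and \<open>w\<close> would lie between \<open>e\<close> and
    \<open>w\<close> or be removed by \<open>q\<close>.\<close>
  have nqw: "nbr q q w"
    unfolding nbr_def
  proof (intro conjI allI impI)
    fix m assume m: "alive q m"
    show "\<not> btw q m w"
    proof
      assume bt: "btw q m w"
      then have mq: "m \<noteq> q" by (auto simp: btw_def)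
      then have am: "alive (q - 1) m" using m by (auto simp: alive_def)
      have nm: "\<not> btw e m w" using nwe am by (auto simp: nbr_def)
      have me: "m \<noteq> e" using m e(2) by (auto simp: alive_def)
      have lt: "m < n" "e < n" "w < n" using m am e w qT S_D by (auto simp: alive_def)
      have ne: "x m \<noteq> x e" "x m \<noteq> x w" "x e \<noteq> x w" "x w \<noteq> x q"
        using x_neq lt me bt wq qT w(4) by (auto simp: btw_def)
      have nb: "\<not> below q m" "\<not> below q w" using alive_antichain[of q q] m aw qT alive_self by blast+
      show False
      proof (cases "x w < x e")
        case True
        have "y e < y w" using alive_xy[OF w(2) ve(1) q1(1)] True by auto
        then have "x w < x q" using nb(2) bl ne by (auto simp: below_def)
        then have "x w < x m" "x m < x e" using bt bl by (auto simp: btw_def below_def)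
        then show False using nm by (auto simp: btw_def)
      next
        case False
        then have "x e < x w" using ne by auto
        then have "x q < x m" "x m < x w" using bt bl by (auto simp: btw_def below_def)
        moreover have "x m < x e" using nm \<open>x e < x w\<close> calculation ne by (auto simp: btw_def)
        moreover have "y e < y m" using alive_xy[OF am ve(1) q1(1)] calculation by auto
        ultimately show False using nb(1) bl by (auto simp: below_def)
      qed
    qed
  qed (use aw wq in auto)
  have nwq: "nbr q w q" using nqw nbr_sym by blast
  have q1': "1 \<le> q" using ve by auto
  have one: "state q q = None \<or> state q w = None" using nbrs_undecided[OF nqw q(1) w(1) q(2) w(3) qT(1)] .
  have notboth: "state q q \<noteq> None \<or> state q w \<noteq> None"
    using state_undecided(4)[OF q1' qT(2) alive_self _ nqw] by blast
  obtain u z where uz: "{u, z} = {q, w}" "u \<noteq> z" "state q u = None" "state q z \<noteq> None"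
    using one notboth wq by (metis insert_commute)
  have S: "u \<in> S" "z \<in> S" "\<not> seal u" "\<not> seal z" using uz q w by (auto simp: doubleton_eq_iff)
  \<comment> \<open>This is the clause of \<open>extends\<close> on death times. An anchored
    \<open>z\<close> is kept alive by \<open>dead\<close> instead.\<close>
  have lock: "death u \<le> death z" if "\<not> anchored z"
  proof (cases "u = q")
    case True
    then have zw: "z = w" using uz by (auto simp: doubleton_eq_iff)
    have "\<not> anchored q" using state_undecided(1)[OF q1' qT(2) alive_self] uz True by auto
    then show ?thesis
      using state_extends[of "q - 1"] ve(5) qT nqw gw uz True zw q1(3) unfolding extends_def by metis
  next
    case False
    then have zw: "z = q" "u = w" using uz by (auto simp: doubleton_eq_iff)
    then show ?thesis
      using state_extends[of "q - 1"] ve(5) qT nqw gw uz that q1(3) unfolding extends_def by metis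
  qed
  \<comment> \<open>This is the last alternative in \<open>nbr_differ\<close>. An anchored
    \<open>z\<close> must be \<open>q\<close>, since \<open>w\<close> was undecided, and then
    \<open>u\<close> is \<open>w\<close>.\<close>
  have hist: "state (z - 1) u = None" if "anchored z"
  proof -
    have "z = q \<or> z = w" using uz by (auto simp: doubleton_eq_iff)
    then have "z = q" using that und(1) by auto
    then have "u = w" using uz by (auto simp: doubleton_eq_iff)
    then show ?thesis using gw \<open>z = q\<close> by simp
  qed
  have perm: "alive t u \<and> alive t z \<and> nbr t u z \<and> state t u = None \<and> state t z \<noteq> None" if "q \<le> t" "t \<le> T" for t
    using that
  proof (induction t rule: dec_induct)
    case base
    show ?case using uz nqw nwq aw by (auto simp: doubleton_eq_iff)
  next
    case (step t)
    let ?p = "Suc t"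
    have t: "1 \<le> t" "?p < n" "?p \<le> T" "t < n" using step q1' T by auto
    have IH: "alive t u" "alive t z" "nbr t u z" "state t u = None" "state t z \<noteq> None" using step by auto
    have du: "death u \<noteq> ?p"
      using dead(2)[OF S(1)] IH(4) t by auto
    have dz: "death z \<noteq> ?p"
    proof
      assume dz: "death z = ?p"
      then have "\<not> anchored z" using dead(1)[OF S(2)] t by auto
      then have "death u \<le> ?p" using lock dz by auto
      then show False using du IH(1) by (auto simp: alive_def)
    qed
    have al: "alive ?p u" "alive ?p z" using alive_step(2)[OF IH(1) t(2)] alive_step(2)[OF IH(2) t(2)] du dz by auto
    have gz: "state ?p z \<noteq> None" using state_keep[of t z ?p] IH t alive_le by auto
    have gzX: "state ?p z = Some X" using display[OF S(2,4) al(2) t(3) gz] .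
    have uzp: "u \<noteq> ?p" "z \<noteq> ?p" using IH by (auto simp: alive_def)
    \<comment> \<open>A point arriving between \<open>u\<close> and \<open>z\<close> would be
      undecided, being next to the decided \<open>z\<close>. Then \<open>u\<close> would be decided
      as well, and both its neighbours would show \<open>X\<close>.\<close>
    have nuz: "nbr ?p u z"
    proof (rule ccontr)
      assume nn: "\<not> nbr ?p u z"
      then obtain m where m: "alive ?p m" "btw u m z" using al uz(2) by (auto simp: nbr_def)
      have mp: "m = ?p"
        using alive_stepD[OF m(1)] m(2) IH(3) by (auto simp: nbr_def)
      have Sp: "?p \<in> S" "\<not> seal ?p"
        using between_S[OF S(1,2) al m(1,2) t(3)] between_no_seal[OF S(1,2) al m(1,2) t(3)] mp by auto
      have np: "nbr ?p ?p s" if s: "s = u \<or> s = z" for s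
        unfolding nbr_def
      proof (intro conjI allI impI)
        fix k assume k: "alive ?p k"
        show "\<not> btw ?p k s"
        proof
          assume bk: "btw ?p k s"
          then have "k \<noteq> ?p" by (auto simp: btw_def)
          then have "alive t k" using alive_stepD k by auto
          moreover have "btw u k z" using bk m(2) mp s by (auto simp: btw_def)
          ultimately show False using IH(3) by (auto simp: nbr_def)
        qed
      qed (use al s uzp in auto)
      have gp: "state ?p ?p = None" using nbrs_undecided[OF np Sp(1) S(2) Sp(2) S(4) t(3)] gz by auto
      have "state ?p u \<noteq> None" using state_undecided(4)[OF _ t(2) alive_self gp np[of u]] by auto
      then have "state ?p u = Some X" using display[OF S(1,3) al(1) t(3)] by auto
      then show False
        using state_undecided(5)[OF _ t(2) alive_self gp np[of u] np[of z] uz(2)] gzX by auto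
    qed
    have "state ?p u = None"
    proof (rule ccontr)
      assume gu: "state ?p u \<noteq> None"
      then have guX: "state ?p u = Some X" using display[OF S(1,3) al(1) t(3)] by auto
      have nu: "\<not> anchored u" using state_undecided(1)[OF t(1,4) IH(1,4)] .
      show False
        using nbr_differ[OF _ t(2) nuz nu gu] hist gzX guX by auto
    qed
    then show ?case using al nuz gz by auto
  qed
  note vf = victim[OF r(3,4,2)]
  have r1: "q \<le> r - 1" "r - 1 \<le> T" "r - 1 < n" using r T by auto
  note P = perm[OF r1(1,2)]
  \<comment> \<open>A later victim would be the only decided unsealed point, hence \<open>z\<close>,
    which \<open>perm\<close> keeps alive.\<close>
  have "f = z" using decided_unique[OF r(3) S(2) vf(1) _ vf(3) S(4) _ _ r1(2)] P vf(4) by auto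
  moreover have "alive r z" using perm[of r] r by auto
  ultimately show False using r by (auto simp: alive_def)
qed

text \<open>A killer \<open>q\<close> that dies is unanchored, so during its life some point arrived below its victim. As
  killers other than the last one have only seals as companions, that point was replaced by a seal.\<close>

lemma seal_between:
  assumes q: "q \<in> killers" "\<not> seal q" and q': "q' \<in> killers" "\<not> seal q'" and r: "r \<in> killers"
    and lt: "q < q'" "q' < r"
  shows "\<exists>s. seal s \<and> q < s \<and> s < q'"
proof -
  \<comment> \<open>\<open>r\<close> is a later killer, so \<open>no_later_killer\<close> forbids
    unsealed companions.\<close>
  have plain: "w = e \<or> seal w"
    if "p \<in> killers" "\<not> seal p" "p < r" "e \<in> S" "death e = p" "w \<in> S" "alive (p - 1) w" for p e w
  proof (rule ccontr)
    assume "\<not> (w = e \<or> seal w)"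
    moreover obtain f where "f \<in> S" "death f = r" using r by (auto simp: killers_def)
    moreover have "r \<le> T" "p \<in> S" using r that S_D by (auto simp: killers_def)
    ultimately show False using no_later_killer[of p e w r f] that by auto
  qed
  have qS: "q \<in> S" "q' \<in> S" "r \<in> S" using q q' r by (auto simp: killers_def)
  then have qT: "q' \<le> T" "r \<le> T" using S_D by auto
  \<comment> \<open>If \<open>q\<close> outlived the arrival of \<open>q'\<close>, it would be an
    unsealed companion of the victim of \<open>q'\<close>.\<close>
  have dq: "death q \<le> q'"
  proof (rule ccontr)
    assume "\<not> death q \<le> q'"
    then have al: "alive (q' - 1) q" "alive q' q" using lt by (auto simp: alive_def)
    obtain e where e: "e \<in> S" "death e = q'" using q' by (auto simp: killers_def)
    have "q = e" using plain[OF q' lt(2) e qS(1) al(1)] q by auto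
    then show False using e al by (auto simp: alive_def)
  qed
  let ?k = "death q"
  have kT: "?k \<le> T" using dq qT by auto
  have kS: "?k \<in> S" "q < ?k" using S_killer[OF qS(1) kT] death_props(1) by auto
  show ?thesis
  proof (cases "seal ?k")
    case True
    then have "?k \<noteq> q'" using q' by auto
    then show ?thesis using True kS dq by (intro exI[of _ ?k]) auto
  next
    case False
    have kk: "?k \<in> killers" using kS qS by (auto simp: killers_def)
    obtain e where e: "e \<in> S" "death e = q" using q by (auto simp: killers_def)
    note ve = victim[OF e S_D(1)[OF qS(1)]]
    have "\<not> anchored q" using dead(1)[OF qS(1) kT] .
    then have "\<not> narrow e" using unanchored_child[of q e] e ve by auto
    then obtain p where p: "q < p" "p < ?k" "below p e" using e by (auto simp: narrow_def)
    \<comment> \<open>The dominator \<open>w\<close> of \<open>p\<close> just before the removal of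
      \<open>q\<close> lies in \<open>S\<close> and is younger than \<open>q\<close>; as a companion
      of the victim \<open>q\<close> it must be a seal.\<close>
    have "p \<le> ?k - 1" "?k - 1 < n" using p kT T by linarith+
    then obtain w where w: "alive (?k - 1) w" "p \<le> w" "w = p \<or> below w p"
      using dominator by blast
    have "below w e" using w p by (auto simp: below_def)
    then have wS: "w \<in> S" using S_below[OF e(1)] w(1) kT by (auto simp: alive_def)
    have "seal w" using plain[OF kk False _ qS(1) refl wS w(1)] w p dq lt by auto
    then show ?thesis using w p dq by (intro exI[of _ w]) (auto simp: alive_def)
  qed
qed

text \<open>Five of them would give seals in the three gaps between the first four, the fifth being
  the later killer required by \<open>seal_between\<close>. There are only two seals.\<close>

lemma card_unsealed_killers: "card {q \<in> killers. \<not> seal q} \<le> 4"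
proof (rule ccontr)
  let ?K = "{q \<in> killers. \<not> seal q}"
  assume "\<not> card ?K \<le> 4"
  then have c5: "5 \<le> card ?K" by simp
  define xs where "xs = sorted_list_of_set ?K"
  have fin: "finite ?K" using finite_S by (auto simp: killers_def)
  have len: "length xs = card ?K" by (simp add: xs_def)
  have srt: "sorted_wrt (<) xs" by (simp add: xs_def)
  have inK: "xs ! i \<in> ?K" if "i < 5" for i
    using that len c5 fin nth_mem[of i xs] by (simp add: xs_def)
  have lt: "xs ! i < xs ! j" if "i < j" "j < 5" for i j
    using sorted_wrt_nth_less[OF srt that(1)] that len c5 by auto
  have ex: "\<exists>s. seal s \<and> xs ! i < s \<and> s < xs ! Suc i" if "i < 3" for i
    using seal_between[of "xs ! i" "xs ! Suc i" "xs ! 4"] inK[of i] inK[of "Suc i"] inK[of 4]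
      lt[of i "Suc i"] lt[of "Suc i" 4] that by auto
  obtain s0 where s0: "seal s0" "s0 < xs ! 1" using ex[of 0] by auto
  obtain s1 where s1: "seal s1" "xs ! 1 < s1" "s1 < xs ! 2" using ex[of 1] by (auto simp: numeral_2_eq_2)
  obtain s2 where s2: "seal s2" "xs ! 2 < s2" using ex[of 2] by auto
  have "card {s0, s1, s2} = 3" using s0 s1 s2 by auto
  moreover have "card {s0, s1, s2} \<le> card {s. seal s}"
    by (rule card_mono) (use s0 s1 s2 finite_subset[OF _ finite_S] in \<open>auto simp: seal_def\<close>)
  ultimately show False using card_seals by linarith
qed

text \<open>Five points alive at time \<open>T\<close>, and one victim for each of at most four
  unsealed and two sealed killers.\<close>

lemma card_mono_octant: "card S \<le> 11"
proof -
  have "killers \<subseteq> {q \<in> killers. \<not> seal q} \<union> {s. seal s}" by auto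
  then have "card killers \<le> card ({q \<in> killers. \<not> seal q} \<union> {s. seal s})"
    by (rule card_mono[rotated]) (use finite_S in \<open>auto simp: seal_def killers_def intro: finite_subset\<close>)
  also have "\<dots> \<le> card {q \<in> killers. \<not> seal q} + card {s. seal s}" by (rule card_Un_le)
  finally show ?thesis using card_S card_unsealed_killers card_seals by linarith
qed

end

theorem (in staircase) two_colouring:
  "\<exists>colour :: nat \<Rightarrow> bool. \<forall>a b T. a \<le> x 1 \<longrightarrow> b \<le> y 0 \<longrightarrow> T < n \<longrightarrow>
     12 \<le> card {e. e \<le> T \<and> x e < a \<and> y e < b} \<longrightarrow>
     (\<forall>k. \<exists>e. e \<le> T \<and> x e < a \<and> y e < b \<and> colour e = k)"
proof -
  obtain state where state: "\<And>t. 1 \<le> t \<Longrightarrow> t < n \<Longrightarrow> proper t (state t)"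
    "\<And>t. 1 \<le> t \<Longrightarrow> Suc t < n \<Longrightarrow> extends t (state t) (state (Suc t))" "\<exists>b. state 1 0 = Some b \<and> state 1 1 = Some (\<not> b)"
    using sequence_exists by blast
  interpret coloured n x y state
    by unfold_locales (use state in auto)
  show ?thesis
  proof (intro exI[of _ colour] allI impI, rule ccontr)
    fix a b T k
    let ?S = "{e. e \<le> T \<and> x e < a \<and> y e < b}"
    assume *: "a \<le> x 1" "b \<le> y 0" "T < n" "12 \<le> card ?S"
      "\<not> (\<exists>e. e \<le> T \<and> x e < a \<and> y e < b \<and> colour e = k)"
    interpret mono_octant n x y state a b T "\<not> k" ?S
      by unfold_locales (use * in auto)
    show False using card_mono_octant *(4) by linarith
  qed
qed

section \<open>More colours\<close>

locale ranked =
  fixes f1 f2 f3 :: "'i \<Rightarrow> real" and U :: "'i set"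
  assumes finite_U: "finite U"
    and inj1: "inj_on f1 U" and inj2: "inj_on f2 U" and inj3: "inj_on f3 U"
begin

definition oct :: "'i set \<Rightarrow> real \<Rightarrow> real \<Rightarrow> real \<Rightarrow> 'i set" where
  "oct I a b c = {i \<in> I. f1 i < a \<and> f2 i < b \<and> f3 i < c}"

definition lt :: "'i \<Rightarrow> 'i \<Rightarrow> bool" where
  "lt i j \<longleftrightarrow> f1 i < f1 j \<and> f2 i < f2 j \<and> f3 i < f3 j"

definition incomparable :: "'i set \<Rightarrow> bool" where
  "incomparable I \<longleftrightarrow> (\<forall>i\<in>I. \<forall>j\<in>I. \<not> lt i j)"

definition colourable :: "nat \<Rightarrow> nat set \<Rightarrow> 'i set \<Rightarrow> bool" where
  "colourable m C I \<longleftrightarrow> (\<exists>col. (\<forall>i\<in>I. col i \<in> C) \<and>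
     (\<forall>a b c. m \<le> card (oct I a b c) \<longrightarrow> C \<subseteq> col ` oct I a b c))"

text \<open>Sorting by \<open>f3\<close> turns the third coordinate into arrival time, and
  incomparability becomes the assumption \<open>antichain\<close> of
  \<open>staircase\<close>.\<close>

lemma two_colouring:
  assumes I: "I \<subseteq> U" and inc: "incomparable I"
  shows "\<exists>col :: 'i \<Rightarrow> bool. \<forall>a b c k. 12 \<le> card (oct I a b c) \<longrightarrow> (\<exists>i\<in>oct I a b c. col i = k)"
proof -
  have fin: "finite I" using I finite_U finite_subset by blast
  obtain ys where ys: "set ys = I" "distinct ys" using finite_distinct_list[OF fin] by blast
  define xs where "xs = sort_key f3 ys"
  have xs: "set xs = I" "distinct xs" "sorted (map f3 xs)" using ys by (auto simp: xs_def)
  have "distinct (map f3 xs)" using xs inj_on_subset[OF inj3 I] by (simp add: distinct_map)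
  then have "sorted_wrt (<) (map f3 xs)" using xs by (simp add: strict_sorted_iff)
  then have inc3: "f3 (xs ! i) < f3 (xs ! j)" if "i < j" "j < length xs" for i j
    using that sorted_wrt_nth_less by fastforce
  \<comment> \<open>The element 0 keeps \<open>V\<close> nonempty, so that \<open>lo < hi\<close>
    even if \<open>I\<close> is empty.\<close>
  define V where "V = insert 0 (f1 ` I \<union> f2 ` I)"
  define lo where "lo = Min V - 1"
  define hi where "hi = Max V + 1"
  have finV: "finite V" using fin by (simp add: V_def)
  have V: "lo < r \<and> r < hi" if "r \<in> V" for r
    using Min_le[OF finV that] Max_ge[OF finV that] unfolding lo_def hi_def by linarith
  have lohi: "lo < hi" using V[of 0] by (simp add: V_def)
  \<comment> \<open>Indices are shifted by two, as 0 and 1 are the artificial ends.\<close>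
  define n where "n = length xs + 2"
  define e where "e p = xs ! (p - 2)" for p
  define x where "x p = (if p = 0 then lo else if p = 1 then hi else f1 (e p))" for p
  define y where "y p = (if p = 0 then hi else if p = 1 then lo else f2 (e p))" for p
  have eI: "e p \<in> I" if "2 \<le> p" "p < n" for p
    using that xs by (auto simp: e_def n_def intro!: nth_mem)
  have einj: "e p = e q \<longleftrightarrow> p = q" if "2 \<le> p" "p < n" "2 \<le> q" "q < n" for p q
    using that nth_eq_iff_index_eq[OF xs(2), of "p - 2" "q - 2"] by (auto simp: e_def n_def)
  have bnd: "lo < f1 (e p)" "f1 (e p) < hi" "lo < f2 (e p)" "f2 (e p) < hi" if "2 \<le> p" "p < n" for p
    using V eI[OF that] by (auto simp: V_def)
  have ge2: "2 \<le> p" if "p \<noteq> 0" "p \<noteq> 1" for p :: nat using that by linarith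
  interpret st: staircase n x y
  proof
    show "2 \<le> n" by (simp add: n_def)
    show "inj_on x {..<n}"
    proof (rule inj_onI)
      fix p q assume *: "p \<in> {..<n}" "q \<in> {..<n}" "x p = x q"
      show "p = q"
      proof (cases "2 \<le> p \<and> 2 \<le> q")
        case True
        then have "f1 (e p) = f1 (e q)" using * by (auto simp: x_def)
        then have "e p = e q" using inj_onD[OF inj1, of "e p" "e q"] eI True * I by auto
        then show ?thesis using einj True * by auto
      next
        case False
        then show ?thesis using * bnd(1,2)[of p] bnd(1,2)[of q] lohi ge2[of p] ge2[of q]
          by (auto simp: x_def split: if_splits)
      qed
    qed
    show "inj_on y {..<n}"
    proof (rule inj_onI)
      fix p q assume *: "p \<in> {..<n}" "q \<in> {..<n}" "y p = y q"
      show "p = q"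
      proof (cases "2 \<le> p \<and> 2 \<le> q")
        case True
        then have "f2 (e p) = f2 (e q)" using * by (auto simp: y_def)
        then have "e p = e q" using inj_onD[OF inj2, of "e p" "e q"] eI True * I by auto
        then show ?thesis using einj True * by auto
      next
        case False
        then show ?thesis using * bnd(3,4)[of p] bnd(3,4)[of q] lohi ge2[of p] ge2[of q]
          by (auto simp: y_def split: if_splits)
      qed
    qed
    fix p q assume pq: "p < q" "q < n"
    show "\<not> (x p < x q \<and> y p < y q)"
    proof
      assume *: "x p < x q \<and> y p < y q"
      have q0: "q \<noteq> 0" using pq by auto
      have p2: "2 \<le> p"
      proof (rule ge2)
        show "p \<noteq> 0"
        proof
          assume "p = 0"
          then show False using * q0 lohi bnd(4)[of q] ge2[of q] pq by (auto simp: y_def split: if_splits)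
        qed
        show "p \<noteq> 1"
        proof
          assume "p = 1"
          then show False using * q0 lohi bnd(2)[of q] ge2[of q] pq by (auto simp: x_def split: if_splits)
        qed
      qed
      then have "f1 (e p) < f1 (e q)" "f2 (e p) < f2 (e q)" using * pq by (auto simp: x_def y_def)
      moreover have "f3 (e p) < f3 (e q)" using inc3[of "p - 2" "q - 2"] p2 pq by (auto simp: e_def n_def)
      ultimately show False using inc eI[of p] eI[of q] p2 pq by (auto simp: incomparable_def lt_def)
    qed
  next
    fix p assume "p < n" "p \<noteq> 0"
    then show "x 0 < x p \<and> y p < y 0" using bnd[of p] lohi ge2[of p] by (auto simp: x_def y_def)
  next
    fix p assume "p < n" "p \<noteq> 1"
    then show "x p < x 1 \<and> y 1 < y p" using bnd[of p] lohi ge2[of p] by (auto simp: x_def y_def)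
  qed
  obtain col :: "nat \<Rightarrow> bool" where col: "\<forall>a b T. a \<le> x 1 \<longrightarrow> b \<le> y 0 \<longrightarrow> T < n \<longrightarrow>
      12 \<le> card {e. e \<le> T \<and> x e < a \<and> y e < b} \<longrightarrow>
      (\<forall>k. \<exists>e. e \<le> T \<and> x e < a \<and> y e < b \<and> col e = k)"
    using st.two_colouring by (elim exE) (rule that)
  have bij: "bij_betw e {2..<n} I"
  proof (rule bij_betwI')
    fix i assume "i \<in> I"
    then obtain j where "j < length xs" "xs ! j = i" using xs by (auto simp: in_set_conv_nth)
    then show "\<exists>p\<in>{2..<n}. i = e p" by (intro bexI[of _ "j + 2"]) (auto simp: e_def n_def)
  qed (use einj eI in auto)
  define idx where "idx = the_inv_into {2..<n} e"
  have idx: "idx (e p) = p" if "2 \<le> p" "p < n" for p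
    using the_inv_into_f_f[of e "{2..<n}" p] bij that by (auto simp: idx_def bij_betw_def)
  show ?thesis
  proof (intro exI[of _ "\<lambda>i. col (idx i)"] allI impI)
    fix a b c k assume big: "12 \<le> card (oct I a b c)"
    let ?E = "{p. 2 \<le> p \<and> p < n \<and> f3 (e p) < c}"
    have finE: "finite ?E" by simp
    have "oct I a b c \<noteq> {}" using big by auto
    then obtain i where "i \<in> I" "f3 i < c" by (auto simp: oct_def)
    then have neE: "?E \<noteq> {}" using bij by (force simp: bij_betw_def)
    define T where "T = Max ?E"
    have TE: "T \<in> ?E" using Max_in[OF finE neE] by (simp add: T_def)
    have le: "p \<le> T \<longleftrightarrow> f3 (e p) < c" if "2 \<le> p" "p < n" for p
    proof
      assume "p \<le> T"
      then consider "p = T" | "p < T" by linarith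
      then show "f3 (e p) < c"
      proof cases
        case 2
        then have "f3 (e p) < f3 (e T)" using inc3[of "p - 2" "T - 2"] that TE by (auto simp: e_def n_def)
        then show ?thesis using TE by auto
      qed (use TE in auto)
    next
      assume "f3 (e p) < c"
      then show "p \<le> T" using Max_ge[OF finE, of p] that by (auto simp: T_def)
    qed
    \<comment> \<open>Cutting the bounds off at \<open>hi\<close> excludes the two ends and loses no
      point of \<open>I\<close>.\<close>
    define W where "W = {p. p \<le> T \<and> x p < min a hi \<and> y p < min b hi}"
    have W: "p \<in> W \<longleftrightarrow> 2 \<le> p \<and> p < n \<and> e p \<in> oct I a b c" for p
    proof (cases "2 \<le> p \<and> p < n")
      case True
      then show ?thesis using le[of p] eI[of p] bnd[of p] by (auto simp: W_def oct_def x_def y_def)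
    next
      case False
      then consider "p = 0" | "p = 1" | "n \<le> p" by linarith
      then show ?thesis using TE False by cases (auto simp: W_def x_def y_def)
    qed
    have "bij_betw e W (oct I a b c)"
    proof (rule bij_betw_subset[OF bij])
      show "W \<subseteq> {2..<n}" using W by (meson atLeastLessThan_iff subsetI)
      show "e ` W = oct I a b c"
      proof
        show "oct I a b c \<subseteq> e ` W"
        proof
          fix i assume i: "i \<in> oct I a b c"
          then obtain p where p: "p \<in> {2..<n}" "i = e p" using bij by (auto simp: oct_def bij_betw_def)
          then have "p \<in> W" using W[of p] i by auto
          then show "i \<in> e ` W" using p by blast
        qed
      qed (use W in blast)
    qed
    then have "12 \<le> card W" using big bij_betw_same_card by metis
    moreover have "min a hi \<le> x 1" "min b hi \<le> y 0" "T < n" using TE by (auto simp: x_def y_def)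
    ultimately obtain p where "p \<in> W" "col p = k" using col unfolding W_def by blast
    then show "\<exists>i\<in>oct I a b c. col (idx i) = k"
      using W[of p] idx[of p] by (intro bexI[of _ "e p"]) auto
  qed
qed

text \<open>An additional colour replaces the bound \<open>m\<close> by \<open>12 * m * m\<close>:
  one class of a two-colouring gets \<open>c0\<close>, the other, \<open>B\<close>, the remaining
  colours. The work is to find \<open>m\<close> points of \<open>B\<close> in every large
  octant.\<close>

lemma incomparable_colourable:
  assumes "I \<subseteq> U" "incomparable I" "finite C" "card C = Suc k"
  shows "colourable (12 ^ (2 ^ k - 1)) C I"
  using assms
proof (induction k arbitrary: I C)
  case 0
  then obtain c where C: "C = {c}" by (metis One_nat_def card_1_singletonE)
  show ?case unfolding colourable_def
  proof (intro exI[of _ "\<lambda>_. c"] conjI allI impI)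
    fix a b d assume "12 ^ (2 ^ 0 - 1) \<le> card (oct I a b d)"
    then have "oct I a b d \<noteq> {}" by auto
    then show "C \<subseteq> (\<lambda>_. c) ` oct I a b d" using C by auto
  qed (use C in auto)
next
  case (Suc k)
  let ?m = "12 ^ (2 ^ k - 1) :: nat"
  have fin: "finite I" using Suc.prems(1) finite_U finite_subset by blast
  obtain c0 where c0: "c0 \<in> C" using Suc.prems by fastforce
  obtain two :: "'i \<Rightarrow> bool" where two: "\<And>a b c k. 12 \<le> card (oct I a b c) \<Longrightarrow> \<exists>i\<in>oct I a b c. two i = k"
    using two_colouring[OF Suc.prems(1,2)] by blast
  define B where "B = {i \<in> I. two i}"
  have "colourable ?m (C - {c0}) B"
  proof (rule Suc.IH)
    show "B \<subseteq> U" "incomparable B" using Suc.prems by (auto simp: B_def incomparable_def)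
    show "finite (C - {c0})" "card (C - {c0}) = Suc k" using Suc.prems c0 by auto
  qed
  then obtain col where col: "\<And>i. i \<in> B \<Longrightarrow> col i \<in> C - {c0}"
    "\<And>a b c. ?m \<le> card (oct B a b c) \<Longrightarrow> C - {c0} \<subseteq> col ` oct B a b c"
    unfolding colourable_def by blast
  show ?case unfolding colourable_def
  proof (intro exI[of _ "\<lambda>i. if two i then col i else c0"] conjI allI impI ballI)
    fix i assume "i \<in> I"
    then show "(if two i then col i else c0) \<in> C" using col(1)[of i] c0 by (auto simp: B_def)
  next
    fix a b c assume big: "12 ^ (2 ^ Suc k - 1) \<le> card (oct I a b c)"
    have pos: "1 \<le> (2::nat) ^ k" by simp
    have "2 ^ Suc k - 1 = Suc ((2 ^ k - 1) + (2 ^ k - 1) :: nat)" unfolding power_Suc using pos by linarith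
    then have m: "12 ^ (2 ^ Suc k - 1) = 12 * (?m * ?m)" by (simp only: power_add power_Suc)
    have m1: "1 \<le> ?m" by simp
    have "12 \<le> 12 * (?m * ?m)" using m1 by (simp add: Suc_le_eq)
    then have W12: "12 \<le> card (oct I a b c)" using big m by linarith
    let ?W = "oct I a b c"
    let ?WB = "oct B a b c"
    have finW: "finite ?W" "finite ?WB" using fin by (auto simp: oct_def B_def)
    have WB: "?WB = {i \<in> ?W. two i}" by (auto simp: oct_def B_def)
    have c0in: "c0 \<in> (\<lambda>i. if two i then col i else c0) ` ?W" using two[OF W12, of False] by force
    have many: "?m \<le> card ?WB"
    proof (rule ccontr)
      assume "\<not> ?m \<le> card ?WB"
      then have few: "Suc (card ?WB) \<le> ?m" by simp
      \<comment> \<open>The covering octants: \<open>a'\<close> and \<open>c'\<close> are original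
        bounds or coordinates of points of \<open>?WB\<close>, and \<open>bb a' c'\<close> is the
        largest second bound up to \<open>b\<close> that keeps \<open>?WB\<close> out.\<close>
      define As where "As = insert a (f1 ` ?WB)"
      define Cs where "Cs = insert c (f3 ` ?WB)"
      define bb where "bb a' c' = Min (insert b (f2 ` {i \<in> ?WB. f1 i < a' \<and> f3 i < c'}))" for a' c'
      have finb: "finite (insert b (f2 ` {i \<in> ?WB. f1 i < a' \<and> f3 i < c'}))" for a' c'
        by (intro finite.insertI finite_imageI) (rule finite_subset[OF _ finW(2)], blast)
      have finAC: "finite As" "finite Cs" using finW by (auto simp: As_def Cs_def)
      have "card As \<le> Suc (card ?WB)" "card Cs \<le> Suc (card ?WB)"
        using card_insert_le_m1[of _ "f1 ` ?WB"] card_image_le[OF finW(2), of f1] card_image_le[OF finW(2), of f3]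
        by (auto simp: As_def Cs_def card_insert_if finW)
      then have cAC: "card As \<le> ?m" "card Cs \<le> ?m" using few by auto
      \<comment> \<open>Such an octant contains no point of \<open>B\<close>, so by
        \<open>two\<close> it has fewer than 12 points.\<close>
      have red: "card (oct I a' (bb a' c') c') \<le> 11" if "a' \<in> As" "c' \<in> Cs" for a' c'
      proof (rule ccontr)
        assume "\<not> card (oct I a' (bb a' c') c') \<le> 11"
        then have "12 \<le> card (oct I a' (bb a' c') c')" by simp
        from two[OF this, of True] obtain i where i: "i \<in> oct I a' (bb a' c') c'" "two i" by blast
        have "a' \<le> a" "c' \<le> c" using that by (auto simp: As_def Cs_def oct_def)
        moreover have "bb a' c' \<le> b" unfolding bb_def by (rule Min_le[OF finb]) blast
        ultimately have "i \<in> ?WB" using i by (auto simp: oct_def B_def)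
        then have "bb a' c' \<le> f2 i" unfolding bb_def by (intro Min_le[OF finb]) (use i in \<open>auto simp: oct_def\<close>)
        then show False using i by (auto simp: oct_def)
      qed
      have sub: "?W \<subseteq> ?WB \<union> (\<Union>(a', c')\<in>As \<times> Cs. oct I a' (bb a' c') c')"
      proof
        fix r assume r: "r \<in> ?W"
        show "r \<in> ?WB \<union> (\<Union>(a', c')\<in>As \<times> Cs. oct I a' (bb a' c') c')"
        proof (cases "two r")
          case False
          have rI: "r \<in> I" using r by (auto simp: oct_def)
          \<comment> \<open>As \<open>a'\<close> and \<open>c'\<close> are the next larger
            coordinates, a point of \<open>?WB\<close> that keeps \<open>r\<close> out would be
            below \<open>r\<close> in all three coordinates.\<close>
          define c' where "c' = Min (insert c (f3 ` {i \<in> ?WB. f3 r < f3 i}))"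
          define a' where "a' = Min (insert a (f1 ` {i \<in> ?WB. f1 r < f1 i}))"
          have fc: "finite (insert c (f3 ` {i \<in> ?WB. f3 r < f3 i}))" and fa: "finite (insert a (f1 ` {i \<in> ?WB. f1 r < f1 i}))"
            using finW by auto
          have c'in: "c' \<in> insert c (f3 ` {i \<in> ?WB. f3 r < f3 i})" unfolding c'_def by (rule Min_in[OF fc]) simp
          have a'in: "a' \<in> insert a (f1 ` {i \<in> ?WB. f1 r < f1 i})" unfolding a'_def by (rule Min_in[OF fa]) simp
          have AC: "a' \<in> As" "c' \<in> Cs" using c'in a'in by (auto simp: As_def Cs_def)
          have rlt: "f1 r < a'" "f3 r < c'" using c'in a'in r by (auto simp: oct_def)
          have bin: "bb a' c' \<in> insert b (f2 ` {i \<in> ?WB. f1 i < a' \<and> f3 i < c'})"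
            unfolding bb_def by (rule Min_in[OF finb]) blast
          have "f2 r < bb a' c'"
          proof (rule ccontr)
            assume nlt: "\<not> f2 r < bb a' c'"
            moreover have "f2 r < b" using r by (auto simp: oct_def)
            ultimately obtain i where i: "i \<in> ?WB" "f1 i < a'" "f3 i < c'" "f2 i \<le> f2 r" using bin by auto
            have iI: "i \<in> I" "i \<noteq> r" using i False by (auto simp: oct_def B_def)
            have ne: "f1 i \<noteq> f1 r" "f2 i \<noteq> f2 r" "f3 i \<noteq> f3 r"
              using inj_onD[OF inj1, of i r] inj_onD[OF inj2, of i r] inj_onD[OF inj3, of i r] iI rI Suc.prems(1) by auto
            have "\<not> f3 r < f3 i" using Min_le[OF fc, of "f3 i"] i by (auto simp: c'_def[symmetric])
            moreover have "\<not> f1 r < f1 i" using Min_le[OF fa, of "f1 i"] i by (auto simp: a'_def[symmetric])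
            ultimately have "lt i r" using ne i(4) by (auto simp: lt_def)
            then show False using Suc.prems(2) iI rI by (auto simp: incomparable_def)
          qed
          then have "r \<in> oct I a' (bb a' c') c'" using rlt rI by (auto simp: oct_def)
          then show ?thesis using AC by blast
        qed (use r WB in auto)
      qed
      have finU: "finite (\<Union>(a', c')\<in>As \<times> Cs. oct I a' (bb a' c') c')"
        using finAC fin by (auto simp: oct_def)
      have "card ?W \<le> card (?WB \<union> (\<Union>(a', c')\<in>As \<times> Cs. oct I a' (bb a' c') c'))"
        by (rule card_mono[OF _ sub]) (use finU finW in auto)
      also have "\<dots> \<le> card ?WB + card (\<Union>(a', c')\<in>As \<times> Cs. oct I a' (bb a' c') c')" by (rule card_Un_le)
      also have "card (\<Union>(a', c')\<in>As \<times> Cs. oct I a' (bb a' c') c') \<le> (\<Sum>(a', c')\<in>As \<times> Cs. card (oct I a' (bb a' c') c'))"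
        by (rule order_trans[OF card_UN_le]) (use finAC in \<open>auto simp: case_prod_unfold\<close>)
      also have "\<dots> \<le> (\<Sum>p\<in>As \<times> Cs. 11)" by (rule sum_mono) (use red in auto)
      also have "\<dots> = card As * card Cs * 11" using finAC by (simp add: card_cartesian_product)
      also have "\<dots> \<le> ?m * ?m * 11" using mult_le_mono[OF cAC] by simp
      finally have "card ?W \<le> card ?WB + 11 * (?m * ?m)" by simp
      moreover have "card ?WB < ?m * ?m" using few m1 by (metis Suc_le_eq le_trans mult.right_neutral mult_le_mono2 not_le)
      ultimately show False using big m by linarith
    qed
    have "C - {c0} \<subseteq> (\<lambda>i. if two i then col i else c0) ` ?W"
    proof
      fix x assume "x \<in> C - {c0}"
      then obtain i where "i \<in> ?WB" "x = col i" using col(2)[OF many] by blast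
      then show "x \<in> (\<lambda>i. if two i then col i else c0) ` ?W" by (intro image_eqI[of _ _ i]) (auto simp: oct_def B_def)
    qed
    then show "C \<subseteq> (\<lambda>i. if two i then col i else c0) ` ?W" using c0in by blast
  qed
qed

end

text \<open>\<open>fold_bound k\<close> belongs to \<open>k + 1\<close> colours. In the recursion,
  the first summand is the bound for antichains with \<open>k + 2\<close> colours, the second the
  pigeonhole count for \<open>k + 2\<close> classes of fewer than \<open>fold_bound k\<close>
  points.\<close>

fun fold_bound :: "nat \<Rightarrow> nat" where
  "fold_bound 0 = 1"
| "fold_bound (Suc k) = 12 ^ (2 ^ Suc k - 1) + Suc (Suc k) * (fold_bound k - 1)"

lemma fold_bound_pos: "1 \<le> fold_bound k"
  by (cases k) (simp_all add: Suc_le_eq)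

text \<open>In the induction step, with \<open>p = 2 ^ k\<close>, both summands are at most
  \<open>12 ^ (4 * p - 1)\<close>, so the sum is at most \<open>12 ^ (4 * p)\<close>, and
  \<open>4 * p \<le> 6 * p - 2\<close>.\<close>

lemma fold_bound_le: "fold_bound (Suc k) \<le> 12 ^ (2 ^ Suc k + 2 ^ k - 2)"
proof (induction k)
  case (Suc k)
  define p :: nat where "p = 2 ^ k"
  have p1: "Suc k \<le> p" unfolding p_def by (simp add: Suc_le_eq)
  have e: "2 ^ Suc (Suc k) + 2 ^ Suc k - 2 = Suc (2 ^ Suc (Suc k) - 1 + (2 * p - 2) :: nat)"
    "2 ^ Suc (Suc k) = 4 * p" "2 ^ Suc k = 2 * p"
    using p1 unfolding p_def power_Suc by linarith+
  let ?A = "12 ^ (4 * p - 1) :: nat"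
  have "Suc (Suc (Suc k)) \<le> 12 ^ p"
  proof -
    have "Suc (Suc (Suc k)) \<le> 2 + p" using p1 by linarith
    also have "\<dots> \<le> 12 ^ p"
    proof -
      have "p < 2 ^ p" by simp
      moreover have "(2::nat) ^ p \<le> 12 ^ p" by (rule power_mono) auto
      moreover have "2 * 2 ^ p \<le> (12::nat) ^ p"
      proof -
        have "(2::nat) * 2 ^ p \<le> 2 ^ p * 2 ^ p" using p1 power_increasing[of 1 p "2::nat"] by simp
        also have "\<dots> = 4 ^ p" by (simp add: power_mult_distrib[symmetric])
        also have "\<dots> \<le> 12 ^ p" by (rule power_mono) auto
        finally show ?thesis .
      qed
      moreover have "2 \<le> (2::nat) ^ p" using p1 power_increasing[of 1 p "2::nat"] by simp
      ultimately show ?thesis by linarith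
    qed
    finally show ?thesis .
  qed
  then have "Suc (Suc (Suc k)) * (fold_bound (Suc k) - 1) \<le> 12 ^ p * 12 ^ (3 * p - 2)"
  proof (rule mult_le_mono)
    have "2 ^ Suc k + 2 ^ k - 2 = 3 * p - 2" unfolding p_def by simp
    then show "fold_bound (Suc k) - 1 \<le> 12 ^ (3 * p - 2)" using Suc.IH by (simp del: fold_bound.simps)
  qed
  also have "\<dots> = 12 ^ (p + (3 * p - 2))" by (simp add: power_add)
  also have "\<dots> \<le> ?A" by (rule power_increasing) (use p1 in auto)
  finally have "fold_bound (Suc (Suc k)) \<le> ?A + ?A" using e by simp
  also have "\<dots> \<le> 12 * ?A" by simp
  also have "\<dots> = 12 ^ Suc (4 * p - 1)" by simp
  also have "\<dots> \<le> 12 ^ (2 ^ Suc (Suc k) + 2 ^ Suc k - 2)"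
    by (rule power_increasing) (use e p1 in auto)
  finally show ?case .
qed simp

section \<open>From antichains to arbitrary point sets\<close>

context ranked begin

lemma minimal_below:
  assumes "I \<subseteq> U" "i \<in> I" "\<exists>j\<in>I. lt j i"
  shows "\<exists>m\<in>I. lt m i \<and> (\<forall>j\<in>I. \<not> lt j m)"
proof -
  let ?L = "{j \<in> I. lt j i}"
  have fin: "finite ?L" using assms(1) finite_U finite_subset by fastforce
  have ne: "?L \<noteq> {}" using assms by auto
  define m where "m = arg_min_on f1 ?L"
  have m: "m \<in> ?L" using arg_min_if_finite(1)[OF fin ne] by (simp add: m_def)
  have least: "f1 m \<le> f1 j" if "j \<in> ?L" for j using arg_min_least[OF fin ne that] by (simp add: m_def)
  have "\<not> lt j m" if "j \<in> I" for j
  proof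
    assume jm: "lt j m"
    then have "j \<in> ?L" using m that by (auto simp: lt_def)
    then show False using least[of j] jm by (auto simp: lt_def)
  qed
  then show ?thesis using m by auto
qed

text \<open>An octant with few minimal points has many points in some class \<open>J c\<close>.
  These carry all colours except \<open>c\<close>, and the minimal point remembered by any of them
  lies in the octant and has colour \<open>c\<close>.\<close>

lemma all_colourable:
  assumes "I \<subseteq> U" "finite C" "card C = Suc k"
  shows "colourable (fold_bound k) C I"
  using assms
proof (induction k arbitrary: I C)
  case 0
  then obtain c where C: "C = {c}" by (metis One_nat_def card_1_singletonE)
  show ?case unfolding colourable_def
  proof (intro exI[of _ "\<lambda>_. c"] conjI allI impI)
    fix a b d assume "fold_bound 0 \<le> card (oct I a b d)"
    then have "oct I a b d \<noteq> {}" by auto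
    then show "C \<subseteq> (\<lambda>_. c) ` oct I a b d" using C by auto
  qed (use C in auto)
next
  case (Suc k)
  define M where "M = {i \<in> I. \<forall>j\<in>I. \<not> lt j i}"
  have MI: "M \<subseteq> I" by (auto simp: M_def)
  have fin: "finite I" using Suc.prems(1) finite_U finite_subset by blast
  have "colourable (12 ^ (2 ^ Suc k - 1)) C M"
    by (rule incomparable_colourable) (use Suc.prems in \<open>auto simp: M_def incomparable_def\<close>)
  then obtain col0 where col0: "\<And>i. i \<in> M \<Longrightarrow> col0 i \<in> C"
    "\<And>a b c. 12 ^ (2 ^ Suc k - 1) \<le> card (oct M a b c) \<Longrightarrow> C \<subseteq> col0 ` oct M a b c"
    unfolding colourable_def by blast
  have "\<forall>i\<in>I - M. \<exists>m. m \<in> M \<and> lt m i"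
  proof
    fix i assume "i \<in> I - M"
    then show "\<exists>m. m \<in> M \<and> lt m i" using minimal_below[OF Suc.prems(1), of i] by (auto simp: M_def)
  qed
  then obtain mu where mu: "\<And>i. i \<in> I - M \<Longrightarrow> mu i \<in> M \<and> lt (mu i) i" by metis
  define J where "J c = {i \<in> I - M. col0 (mu i) = c}" for c
  have "\<forall>c\<in>C. \<exists>col. (\<forall>i\<in>J c. col i \<in> C - {c}) \<and>
     (\<forall>a b d. fold_bound k \<le> card (oct (J c) a b d) \<longrightarrow> C - {c} \<subseteq> col ` oct (J c) a b d)"
  proof
    fix c assume c: "c \<in> C"
    have "colourable (fold_bound k) (C - {c}) (J c)"
      by (rule Suc.IH) (use Suc.prems c in \<open>auto simp: J_def\<close>)
    then show "\<exists>col. (\<forall>i\<in>J c. col i \<in> C - {c}) \<and>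
     (\<forall>a b d. fold_bound k \<le> card (oct (J c) a b d) \<longrightarrow> C - {c} \<subseteq> col ` oct (J c) a b d)"
      unfolding colourable_def .
  qed
  then obtain colJ where colJ: "\<And>c i. c \<in> C \<Longrightarrow> i \<in> J c \<Longrightarrow> colJ c i \<in> C - {c}"
    "\<And>c a b d. c \<in> C \<Longrightarrow> fold_bound k \<le> card (oct (J c) a b d) \<Longrightarrow> C - {c} \<subseteq> colJ c ` oct (J c) a b d"
    by (metis (no_types, lifting))
  define col where "col i = (if i \<in> M then col0 i else colJ (col0 (mu i)) i)" for i
  show ?case unfolding colourable_def
  proof (intro exI[of _ col] conjI allI impI ballI)
    fix i assume i: "i \<in> I"
    show "col i \<in> C"
    proof (cases "i \<in> M")
      case False
      then have "i \<in> J (col0 (mu i))" "col0 (mu i) \<in> C" using i mu[of i] col0(1) by (auto simp: J_def)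
      then show ?thesis using colJ(1) False by (auto simp: col_def)
    qed (use col0 in \<open>auto simp: col_def\<close>)
  next
    fix a b d assume big: "fold_bound (Suc k) \<le> card (oct I a b d)"
    let ?W = "oct I a b d"
    have finW: "finite ?W" using fin by (auto simp: oct_def)
    have finM: "finite (oct M a b d)" by (rule finite_subset[OF _ finW]) (use MI in \<open>auto simp: oct_def\<close>)
    show "C \<subseteq> col ` ?W"
    proof (cases "12 ^ (2 ^ Suc k - 1) \<le> card (oct M a b d)")
      case True
      have "col0 ` oct M a b d \<subseteq> col ` ?W"
      proof
        fix z assume "z \<in> col0 ` oct M a b d"
        then obtain i where "i \<in> oct M a b d" "z = col0 i" by blast
        then show "z \<in> col ` ?W" using MI by (intro image_eqI[of _ _ i]) (auto simp: oct_def col_def)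
      qed
      then show ?thesis using col0(2)[OF True] by blast
    next
      case False
      have "\<exists>c\<in>C. fold_bound k \<le> card (oct (J c) a b d)"
      proof (rule ccontr)
        assume "\<not> (\<exists>c\<in>C. fold_bound k \<le> card (oct (J c) a b d))"
        then have small: "card (oct (J c) a b d) \<le> fold_bound k - 1" if "c \<in> C" for c
          using that by fastforce
        have "?W \<subseteq> oct M a b d \<union> (\<Union>c\<in>C. oct (J c) a b d)"
          using mu col0(1) by (auto simp: oct_def J_def)
        moreover have "finite (oct (J c) a b d)" for c
          by (rule finite_subset[OF _ finW]) (auto simp: oct_def J_def)
        ultimately have "card ?W \<le> card (oct M a b d \<union> (\<Union>c\<in>C. oct (J c) a b d))"
          using finM Suc.prems(2) by (intro card_mono) auto
        also have "\<dots> \<le> card (oct M a b d) + card (\<Union>c\<in>C. oct (J c) a b d)" by (rule card_Un_le)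
        also have "card (\<Union>c\<in>C. oct (J c) a b d) \<le> (\<Sum>c\<in>C. card (oct (J c) a b d))"
          by (rule card_UN_le[OF Suc.prems(2)])
        also have "\<dots> \<le> (\<Sum>c\<in>C. fold_bound k - 1)" by (rule sum_mono[OF small])
        also have "\<dots> = Suc (Suc k) * (fold_bound k - 1)" using Suc.prems by simp
        finally have "card ?W < fold_bound (Suc k)" using False by simp
        then show False using big by simp
      qed
      then obtain c where c: "c \<in> C" "fold_bound k \<le> card (oct (J c) a b d)" by blast
      have JW: "oct (J c) a b d \<subseteq> ?W" by (auto simp: oct_def J_def)
      have "colJ c ` oct (J c) a b d \<subseteq> col ` ?W"
      proof
        fix z assume "z \<in> colJ c ` oct (J c) a b d"
        then obtain i where "i \<in> oct (J c) a b d" "z = colJ c i" by blast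
        then show "z \<in> col ` ?W" using JW by (intro image_eqI[of _ _ i]) (auto simp: oct_def col_def J_def)
      qed
      moreover have "c \<in> col ` ?W"
      proof -
        have "oct (J c) a b d \<noteq> {}" using c fold_bound_pos[of k] by auto
        then obtain i where i: "i \<in> oct (J c) a b d" by blast
        then have m: "mu i \<in> M" "lt (mu i) i" "col0 (mu i) = c" using mu[of i] by (auto simp: oct_def J_def)
        then have "mu i \<in> ?W" using i MI by (auto simp: oct_def lt_def)
        then show ?thesis using m by (intro image_eqI[of _ _ "mu i"]) (auto simp: col_def)
      qed
      ultimately show ?thesis using colJ(2)[OF c] by blast
    qed
  qed
qed

end

text \<open>Ties between coordinates are broken without losing any octant.\<close>

lemma rank_refinement:
  fixes f :: "'i \<Rightarrow> real"
  assumes "finite I"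
  shows "\<exists>r :: 'i \<Rightarrow> real. inj_on r I \<and> (\<forall>a. \<exists>A. \<forall>i\<in>I. f i \<le> a \<longleftrightarrow> r i < A)"
proof -
  obtain e :: "'i \<Rightarrow> nat" where e: "inj_on e I" using finite_imp_inj_to_nat_seg[OF assms] by blast
  define L where "L i = {j \<in> I. f j < f i \<or> f j = f i \<and> e j < e i}" for i
  define r where "r i = real (card (L i))" for i
  have fin: "finite (L i)" for i using assms by (simp add: L_def)
  have less: "r i < r j" if "i \<in> I" "j \<in> I" "f i < f j \<or> f i = f j \<and> e i < e j" for i j
  proof -
    have "L i \<subset> L j" using that by (auto simp: L_def)
    then show ?thesis using psubset_card_mono[OF fin] by (simp add: r_def)
  qed
  have "inj_on r I"
  proof (rule inj_onI)
    fix i j assume *: "i \<in> I" "j \<in> I" "r i = r j"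
    show "i = j"
    proof (rule ccontr)
      assume "i \<noteq> j"
      then have "e i \<noteq> e j" using e * by (auto simp: inj_on_def)
      then consider "f i < f j \<or> f i = f j \<and> e i < e j" | "f j < f i \<or> f j = f i \<and> e j < e i" by linarith
      then show False using less[of i j] less[of j i] * by cases auto
    qed
  qed
  moreover have "\<exists>A. \<forall>i\<in>I. f i \<le> a \<longleftrightarrow> r i < A" for a
  proof (intro exI[of _ "real (card {j \<in> I. f j \<le> a})"] ballI)
    fix i assume i: "i \<in> I"
    have finS: "finite {j \<in> I. f j \<le> a}" using assms by simp
    show "f i \<le> a \<longleftrightarrow> r i < real (card {j \<in> I. f j \<le> a})"
    proof
      assume "f i \<le> a"
      then have "L i \<subset> {j \<in> I. f j \<le> a}" using i by (auto simp: L_def)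
      then show "r i < real (card {j \<in> I. f j \<le> a})" using psubset_card_mono[OF finS] by (simp add: r_def)
    next
      assume lt: "r i < real (card {j \<in> I. f j \<le> a})"
      show "f i \<le> a"
      proof (rule ccontr)
        assume "\<not> f i \<le> a"
        then have "{j \<in> I. f j \<le> a} \<subseteq> L i" by (auto simp: L_def)
        from card_mono[OF fin this] lt show False by (simp add: r_def)
      qed
    qed
  qed
  ultimately show ?thesis by blast
qed

text \<open>Weak bounds on the coordinates become strict bounds on ranks without ties, to which
  \<open>ranked\<close> applies.\<close>

lemma orthant_colouring:
  fixes h1 h2 h3 :: "'i \<Rightarrow> real"
  assumes "finite I" "finite C" "card C = Suc k"
  shows "\<exists>col :: 'i \<Rightarrow> nat. (\<forall>i\<in>I. col i \<in> C) \<and>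
    (\<forall>a b c. fold_bound k \<le> card {i \<in> I. h1 i \<le> a \<and> h2 i \<le> b \<and> h3 i \<le> c} \<longrightarrow>
       C \<subseteq> col ` {i \<in> I. h1 i \<le> a \<and> h2 i \<le> b \<and> h3 i \<le> c})"
proof -
  obtain r1 :: "'i \<Rightarrow> real" where r1: "inj_on r1 I" "\<forall>a. \<exists>A. \<forall>i\<in>I. h1 i \<le> a \<longleftrightarrow> r1 i < A"
    using rank_refinement[OF assms(1), of h1] by blast
  obtain r2 :: "'i \<Rightarrow> real" where r2: "inj_on r2 I" "\<forall>a. \<exists>A. \<forall>i\<in>I. h2 i \<le> a \<longleftrightarrow> r2 i < A"
    using rank_refinement[OF assms(1), of h2] by blast
  obtain r3 :: "'i \<Rightarrow> real" where r3: "inj_on r3 I" "\<forall>a. \<exists>A. \<forall>i\<in>I. h3 i \<le> a \<longleftrightarrow> r3 i < A"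
    using rank_refinement[OF assms(1), of h3] by blast
  interpret ranked r1 r2 r3 I by unfold_locales (use assms r1 r2 r3 in auto)
  obtain col where col: "\<forall>i\<in>I. col i \<in> C"
     "\<And>a b c. fold_bound k \<le> card (oct I a b c) \<Longrightarrow> C \<subseteq> col ` oct I a b c"
    using all_colourable[OF order_refl assms(2,3)] unfolding colourable_def by blast
  show ?thesis
  proof (intro exI[of _ col] conjI allI impI)
    fix a b c
    obtain A B D where "\<forall>i\<in>I. h1 i \<le> a \<longleftrightarrow> r1 i < A" "\<forall>i\<in>I. h2 i \<le> b \<longleftrightarrow> r2 i < B"
      "\<forall>i\<in>I. h3 i \<le> c \<longleftrightarrow> r3 i < D" using r1(2) r2(2) r3(2) by metis
    then have eq: "{i \<in> I. h1 i \<le> a \<and> h2 i \<le> b \<and> h3 i \<le> c} = oct I A B D" by (auto simp: oct_def)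
    assume "fold_bound k \<le> card {i \<in> I. h1 i \<le> a \<and> h2 i \<le> b \<and> h3 i \<le> c}"
    then show "C \<subseteq> col ` {i \<in> I. h1 i \<le> a \<and> h2 i \<le> b \<and> h3 i \<le> c}" unfolding eq by (rule col(2))
  qed (use col in auto)
qed

section \<open>Families of translates\<close>

text \<open>This turns a colouring of list positions into a partition of the family.\<close>

lemma sum_fibres_mset:
  assumes "finite J" "\<forall>i\<in>#M. col i \<in> J"
  shows "(\<Sum>j\<in>J. image_mset f {#i \<in># M. col i = j#}) = image_mset f M"
  using assms(2)
proof (induction M)
  case (add x M)
  have "(\<Sum>j\<in>J. image_mset f {#i \<in># add_mset x M. col i = j#}) =
      (\<Sum>j\<in>J. (if j = col x then {#f x#} else {#}) + image_mset f {#i \<in># M. col i = j#})"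
    by (rule sum.cong) auto
  also have "\<dots> = {#f x#} + image_mset f M"
    using add assms(1) by (simp add: sum.distrib sum.delta)
  finally show ?case by simp
qed simp

text \<open>By duality, the translates containing \<open>w\<close> correspond to the vectors
  \<open>v i\<close> whose signed coordinates are bounded by those of \<open>w\<close>. Colouring
  list positions instead of sets allows for repeated translates.\<close>

lemma octant_fold_suffices:
  assumes "octant P" shows "fold_suffices P (Suc k) (fold_bound k)"
  unfolding fold_suffices_def
proof (intro allI impI)
  fix X :: "(real ^ 3) set" and F
  assume fam: "family_of_translates P F" and fold: "fold_covering (fold_bound k) F X"
  obtain eps :: "real ^ 3" where P: "P = {x. \<forall>i. eps $ i * x $ i \<ge> 0}"
    using assms by (auto simp: octant_def)
  obtain xs where xs: "mset xs = F" using ex_mset by blast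
  let ?I = "{..<length xs}"
  have "\<forall>i\<in>?I. \<exists>v. xs ! i = (\<lambda>x. v + x) ` P"
    using fam xs by (auto simp: family_of_translates_def)
  then obtain v where v: "\<And>i. i < length xs \<Longrightarrow> xs ! i = (\<lambda>x. v i + x) ` P" by (metis lessThan_iff)
  have mem: "w \<in> xs ! i \<longleftrightarrow> eps $ 1 * v i $ 1 \<le> eps $ 1 * w $ 1 \<and>
      eps $ 2 * v i $ 2 \<le> eps $ 2 * w $ 2 \<and> eps $ 3 * v i $ 3 \<le> eps $ 3 * w $ 3"
    if "i < length xs" for i w
  proof -
    have "w \<in> xs ! i \<longleftrightarrow> w - v i \<in> P"
      using v[OF that] by (auto simp: image_iff intro: bexI[of _ "w - v i"])
    then show ?thesis by (simp add: P forall_3 right_diff_distrib)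
  qed
  obtain col :: "nat \<Rightarrow> nat" where col: "\<forall>i\<in>?I. col i \<in> {1..Suc k}"
    "\<And>a b c. fold_bound k \<le> card {i \<in> ?I. eps $ 1 * v i $ 1 \<le> a \<and> eps $ 2 * v i $ 2 \<le> b \<and> eps $ 3 * v i $ 3 \<le> c} \<Longrightarrow>
       {1..Suc k} \<subseteq> col ` {i \<in> ?I. eps $ 1 * v i $ 1 \<le> a \<and> eps $ 2 * v i $ 2 \<le> b \<and> eps $ 3 * v i $ 3 \<le> c}"
    using orthant_colouring[of ?I "{1..Suc k}" k "\<lambda>i. eps $ 1 * v i $ 1" "\<lambda>i. eps $ 2 * v i $ 2" "\<lambda>i. eps $ 3 * v i $ 3"]
    by auto
  define G where "G j = image_mset ((!) xs) {#i \<in># mset [0..<length xs]. col i = j#}" for j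
  have "(\<Sum>j\<in>{1..Suc k}. G j) = image_mset ((!) xs) (mset [0..<length xs])"
    unfolding G_def by (rule sum_fibres_mset) (use col in auto)
  also have "\<dots> = F" using xs by (metis map_nth mset_map)
  finally have sum: "(\<Sum>j\<in>{1..Suc k}. G j) = F" .
  have "covering (G j) X" if j: "j \<in> {1..Suc k}" for j
    unfolding covering_def fold_covering_def
  proof
    fix w assume "w \<in> X"
    then have "fold_bound k \<le> size {#S \<in># mset xs. w \<in> S#}"
      using fold xs by (simp add: fold_covering_def)
    also have "\<dots> = card {i. i < length xs \<and> w \<in> xs ! i}"
      by (metis length_filter_conv_card mset_filter size_mset)
    also have "{i. i < length xs \<and> w \<in> xs ! i} = {i \<in> ?I. eps $ 1 * v i $ 1 \<le> eps $ 1 * w $ 1 \<and>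
      eps $ 2 * v i $ 2 \<le> eps $ 2 * w $ 2 \<and> eps $ 3 * v i $ 3 \<le> eps $ 3 * w $ 3}"
      using mem by auto
    finally obtain i where i: "i < length xs" "w \<in> xs ! i" "col i = j"
      using col(2) j mem by blast
    then have "xs ! i \<in># {#S \<in># G j. w \<in> S#}" by (auto simp: G_def)
    then have "{#S \<in># G j. w \<in> S#} \<noteq> {#}" by (metis empty_iff set_mset_empty)
    then have "size {#S \<in># G j. w \<in> S#} \<noteq> 0" by (metis size_eq_0_iff_empty)
    then show "1 \<le> size {#S \<in># G j. w \<in> S#}" by linarith
  qed
  then show "decomposes_into_coverings (Suc k) F X"
    unfolding decomposes_into_coverings_def using sum by blast
qed

lemma fold_suffices_mono: "fold_suffices P k m \<Longrightarrow> m \<le> m' \<Longrightarrow> fold_suffices P k m'"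
  unfolding fold_suffices_def fold_covering_def by (meson order_trans)

theorem theorem1:
  fixes P :: "(real ^ 3) set"
  assumes "octant P"
  shows "cover_decomposable_into_many P \<and>
    (\<forall>k::nat. k \<ge> 2 \<longrightarrow>
      (let m = 12 ^ (2 ^ (k - 1) + 2 ^ (k - 2) - 2) in
         m < 12 ^ (2 ^ k) \<and>
         (\<forall>(X :: (real ^ 3) set) (F :: (real ^ 3) set multiset).
            family_of_translates P F \<and> fold_covering m F X \<longrightarrow> decomposes_into_coverings k F X) \<and>
         decomposition_constant P k \<le> m))"
proof (intro conjI allI impI)
  show "cover_decomposable_into_many P"
    unfolding cover_decomposable_into_many_def cover_decomposable_into_def
    using octant_fold_suffices[OF assms] by (metis One_nat_def Suc_le_D)
next
  fix k :: nat assume "2 \<le> k"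
  \<comment> \<open>\<open>k\<close> colours belong to \<open>fold_bound (k - 1)\<close>, and
    \<open>fold_bound_le\<close> speaks about successors; hence the exponents and
    \<open>k \<ge> 2\<close>.\<close>
  then obtain l where k: "k = Suc (Suc l)" by (metis Suc_le_D numeral_2_eq_2 Suc_le_mono)
  let ?m = "12 ^ (2 ^ (k - 1) + 2 ^ (k - 2) - 2) :: nat"
  have suff: "fold_suffices P k ?m"
    using fold_suffices_mono[OF octant_fold_suffices[OF assms] fold_bound_le] unfolding k by simp
  have "(2::nat) ^ (k - 1) = 2 * 2 ^ l" "(2::nat) ^ (k - 2) = 2 ^ l" "(2::nat) ^ k = 4 * 2 ^ l" "0 < (2::nat) ^ l"
    unfolding k by simp_all
  then have "(2::nat) ^ (k - 1) + 2 ^ (k - 2) - 2 < 2 ^ k" by linarith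
  then have "?m < 12 ^ (2 ^ k)" by (simp add: power_strict_increasing)
  moreover have "decomposition_constant P k \<le> ?m"
    unfolding decomposition_constant_def using suff by (rule Least_le)
  ultimately show "let m = 12 ^ (2 ^ (k - 1) + 2 ^ (k - 2) - 2) in
         m < 12 ^ (2 ^ k) \<and>
         (\<forall>(X :: (real ^ 3) set) (F :: (real ^ 3) set multiset).
            family_of_translates P F \<and> fold_covering m F X \<longrightarrow> decomposes_into_coverings k F X) \<and>
         decomposition_constant P k \<le> m"
    using suff by (auto simp: Let_def fold_suffices_def)
qed

end
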